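(* Let $D\subset\mathbb{C}$ be a domain and let $\mathcal{F}$ be a family of functions holomorphic on $D$, such that for every $f\in\mathcal{F}$ all zeros of $f$ in $D$ have multiplicity at least $2$. Suppose that there exist a non-zero constant $b\in\mathbb{C}$, a non-zero constant $B\in\mathbb{C}$ and a constant $M>0$ (all independent of $f$) such that for every $f\in\mathcal{F}$ and every $z\in D$: (1) if $f(z)=0$, then $f''(z)=b$; (2) if $f''(z)=b$, then $0<|f'''(z)|\leq M$; (3) if $f''(z)=b$, then $(f'(z))^2=B f(z)$. Then $\mathcal{F}$ is normal in $D$.
   Context: A family $\mathcal{F}$ of meromorphic functions on a domain $D$ is normal in $D$ if every sequence $\{f_n\}\subset\mathcal{F}$ contains either a subsequence which converges to a meromorphic function uniformly on each compact subset of $D$, or a subsequence which converges to $\infty$ uniformly on each compact subset of $D$ (convergence understood, as usual for meromorphic functions, with respect to the spherical metric). A function with no zeros in $D$ satisfies the condition on the multiplicity of zeros vacuously. *)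

theory Defs
  imports "HOL-Complex_Analysis.Complex_Analysis"
begin

text \<open>
  The Riemann sphere is the unit sphere of \<^typ>\<open>complex \<times> real\<close>; the spherical (chordal) metric
  is the Euclidean distance there, so that uniform convergence in the spherical metric is an
  instance of \<^const>\<open>uniform_limit\<close>. The point at infinity is the north pole.
\<close>

definition sphere_infinity :: "complex \<times> real" where
  "sphere_infinity = (0, 1)"

definition sphere_point :: "complex \<Rightarrow> complex \<times> real" where
  "sphere_point w =
     ((2 / (1 + (cmod w)\<^sup>2)) *\<^sub>R w, ((cmod w)\<^sup>2 - 1) / ((cmod w)\<^sup>2 + 1))"

lemma dist_sphere_point:
  "dist (sphere_point z) (sphere_point w) =
     2 * cmod (z - w) / (sqrt (1 + (cmod z)\<^sup>2) * sqrt (1 + (cmod w)\<^sup>2))"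
proof -
  define p q where "p = (cmod z)\<^sup>2" and "q = (cmod w)\<^sup>2"
  have pq: "p \<ge> 0" "q \<ge> 0" by (auto simp: p_def q_def)
  then have nz: "1 + p \<noteq> 0" "1 + q \<noteq> 0" "p + 1 \<noteq> 0" "q + 1 \<noteq> 0" by linarith+
  define s where "s = z \<bullet> w"
  have zw: "(cmod (z - w))\<^sup>2 = p - 2 * s + q"
    unfolding p_def q_def s_def power2_norm_eq_inner
    by (simp add: inner_diff_left inner_diff_right inner_commute)
  have "(dist (sphere_point z) (sphere_point w))\<^sup>2
      = (norm ((2 / (1 + p)) *\<^sub>R z - (2 / (1 + q)) *\<^sub>R w))\<^sup>2
        + ((p - 1) / (p + 1) - (q - 1) / (q + 1))\<^sup>2"
    by (simp add: sphere_point_def dist_norm norm_Pair p_def q_def)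
  also have "(norm ((2 / (1 + p)) *\<^sub>R z - (2 / (1 + q)) *\<^sub>R w))\<^sup>2
      = (2 / (1 + p))\<^sup>2 * p - 2 * (2 / (1 + p)) * (2 / (1 + q)) * s + (2 / (1 + q))\<^sup>2 * q"
    unfolding p_def q_def s_def power2_norm_eq_inner
    by (simp add: inner_diff_left inner_diff_right inner_commute power2_eq_square)
  also have "\<dots> + ((p - 1) / (p + 1) - (q - 1) / (q + 1))\<^sup>2
      = 4 * (p - 2 * s + q) / ((1 + p) * (1 + q))"
    using nz by (simp add: divide_simps) algebra
  also have "\<dots> = (2 * cmod (z - w) / (sqrt (1 + p) * sqrt (1 + q)))\<^sup>2"
    using pq by (simp add: power_divide power_mult_distrib zw)
  finally show ?thesis
    unfolding p_def q_def by (subst (asm) power2_eq_iff_nonneg) auto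
qed

lemma dist_sphere_infinity:
  "dist (sphere_point z) sphere_infinity = 2 / sqrt (1 + (cmod z)\<^sup>2)"
proof -
  define p where "p = (cmod z)\<^sup>2"
  have p: "p \<ge> 0" by (simp add: p_def)
  then have nz: "1 + p \<noteq> 0" "p + 1 \<noteq> 0" by linarith+
  have "(dist (sphere_point z) sphere_infinity)\<^sup>2
      = (2 / (1 + p) * cmod z)\<^sup>2 + ((p - 1) / (p + 1) - 1)\<^sup>2"
    using p
    by (simp add: sphere_point_def sphere_infinity_def dist_norm norm_Pair p_def)
  also have "\<dots> = (2 / (1 + p))\<^sup>2 * p + ((p - 1) / (p + 1) - 1)\<^sup>2"
    by (simp only: p_def power_mult_distrib)
  also have "\<dots> = 4 / (1 + p)"
    using nz by (simp add: divide_simps) algebra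
  also have "\<dots> = (2 / sqrt (1 + p))\<^sup>2"
    using p by (simp add: power_divide)
  finally show ?thesis
    unfolding p_def by (subst (asm) power2_eq_iff_nonneg) auto
qed

text \<open>
  The library represents a meromorphic function as a total function with
  \<^const>\<open>nicely_meromorphic_on\<close>: it takes its limit wherever that is finite and the dummy
  value \<open>0\<close> at poles. \<open>sphere_value\<close> replaces that dummy value by infinity.
\<close>

definition sphere_value :: "(complex \<Rightarrow> complex) \<Rightarrow> complex \<Rightarrow> complex \<times> real" where
  "sphere_value f z = (if is_pole f z then sphere_infinity else sphere_point (f z))"

lemma sphere_value_holomorphic:
  assumes "f holomorphic_on D" "open D" "z \<in> D"
  shows "sphere_value f z = sphere_point (f z)"
  using assms not_is_pole_holomorphic[of D z f] by (simp add: sphere_value_def)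

text \<open>
  Normality of a family of functions that are nicely meromorphic on \<open>D\<close> (in particular of
  a family of functions holomorphic on an open set \<open>D\<close>).
\<close>

definition normal_family_on :: "(complex \<Rightarrow> complex) set \<Rightarrow> complex set \<Rightarrow> bool" where
  "normal_family_on \<F> D \<longleftrightarrow>
     (\<forall>f :: nat \<Rightarrow> complex \<Rightarrow> complex. range f \<subseteq> \<F> \<longrightarrow>
       (\<exists>r :: nat \<Rightarrow> nat. strict_mono r \<and>
         ((\<exists>g. g nicely_meromorphic_on D \<and>
            (\<forall>K. compact K \<and> K \<subseteq> D \<longrightarrow>
               uniform_limit K (\<lambda>n. sphere_value (f (r n))) (sphere_value g) sequentially)) \<or>
          (\<forall>K. compact K \<and> K \<subseteq> D \<longrightarrow>
             uniform_limit K (\<lambda>n. sphere_value (f (r n))) (\<lambda>_. sphere_infinity) sequentially))))"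

end

theory Submission
  imports Defs
begin

text \<open>
  Condition (1) makes every zero of \<open>f\<close> exactly double, so on discs \<open>f = (b/2) u\<^sup>2\<close> with \<open>u\<close>
  holomorphic. With the defect $w = u'^2 + u u'' - 1$ one has $f'' = b(w + 1)$ and $f''' = b w'$, so the
  hypotheses say that $u'^2 = 1$ at zeros of \<open>u\<close>, that all zeros of \<open>w\<close> are simple with
  $|w'| \le M/|b|$, and that at a zero of \<open>w\<close> either $u = 0$ or $u'^2 = \beta$, where
  $\beta = B/(2b)$. If the family were not locally bounded in the sense of Marty, a
  Zalcman-type zoom $u(a + \rho\zeta)/\rho$ would produce, in the limit $\rho \to 0$, an entire
  function \<open>v\<close> with bounded spherical derivative and $|v'(0)| \ge 3$ whose defect has only
  multiple zeros. A zero of \<open>v\<close> is impossible, because near it the multiple zero of the limit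
  defect would have to split into simple zeros on which too many other functions vanish. Hence
  \<open>v\<close> has no zeros, so $v(z) = e^{az + d}$ with $a \neq 0$, and then the defect
  $2a^2v^2 - 1$ has simple zeros: a contradiction.
\<close>

section \<open>Limits of quotients and Hurwitz-type lemmas\<close>

text \<open>The scaling \<open>u(a + \<rho>\<zeta>)/\<rho>\<close> preserves \<open>u'\<close> and
  \<open>w\<close> and multiplies \<open>w'\<close> by \<open>\<rho>\<close>, so every condition on
  a root survives a zoom unchanged except the upper bound on \<open>w'\<close>, which shrinks to 0.
  This is the reason for working with the root. The obstacle is a zero x of the limit. Following the
  simple zeros that collide there would be laborious; instead one divides. A function that vanishes
  at all simple zeros of the approximating defect is a holomorphic multiple of it, the maximum
  principle bounds the quotient independently of n, and the limit inherits an inequality between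
  orders of vanishing at x. The case \<beta> = 1 is separate because zeros of the approximating
  defects near x may then fail to be zeros of the approximating functions. The threshold 3 exceeds
  the value 1 of |u'| at zeros of u. This makes the zoom rate continuous across these zeros, and it
  excludes the limits z - x and x - z, whose defect vanishes identically.\<close>

lemma holomorphic_quotient_simple_zeros:
  assumes A: "A holomorphic_on S" and W: "W holomorphic_on S" and "open S"
    and zeros: "\<And>z. z \<in> S \<Longrightarrow> W z = 0 \<Longrightarrow> A z = 0 \<and> deriv W z \<noteq> 0"
  obtains H where "H holomorphic_on S" "\<And>z. z \<in> S \<Longrightarrow> A z = W z * H z"
    "\<And>z. z \<in> S \<Longrightarrow> W z = 0 \<Longrightarrow> H z = deriv A z / deriv W z"
proof -
  \<comment> \<open>The value at a zero of \<open>W\<close> is the one given by l'Hopital. It is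
    exported as the third conclusion so that a caller can see where the quotient vanishes and divide
    by \<open>W\<close> a second time.\<close>
  define H where "H = (\<lambda>z. if W z = 0 then deriv A z / deriv W z else A z / W z)"
  have "\<exists>N. open N \<and> z \<in> N \<and> H holomorphic_on N" if z: "z \<in> S" for z
  proof (cases "W z = 0")
    case False
    have cont: "continuous_on S W"
      using W holomorphic_on_imp_continuous_on by blast
    have "open (S \<inter> W -` (- {0}))"
      by (rule continuous_open_preimage[OF cont \<open>open S\<close>]) auto
    moreover have "H holomorphic_on S \<inter> W -` (- {0})"
    proof (rule holomorphic_transform)
      show "(\<lambda>z. A z / W z) holomorphic_on S \<inter> W -` (- {0})"
        by (intro holomorphic_intros holomorphic_on_subset[OF A] holomorphic_on_subset[OF W]) auto
    qed (auto simp: H_def)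
    ultimately show ?thesis
      using False z by blast
  next
    case True
    define fA where "fA = (\<lambda>x. if x = z then deriv A z else (A x - A z) / (x - z))"
    define fW where "fW = (\<lambda>x. if x = z then deriv W z else (W x - W z) / (x - z))"
    have holA: "fA holomorphic_on S" and holW: "fW holomorphic_on S"
      unfolding fA_def fW_def using A W \<open>open S\<close> by (auto intro: pole_lemma_open)
    have 0: "A z = 0" "deriv W z \<noteq> 0"
      using zeros z True by auto
    have op: "open (S \<inter> fW -` (- {0}))"
      by (rule continuous_open_preimage[OF holomorphic_on_imp_continuous_on[OF holW] \<open>open S\<close>]) auto
    have "H holomorphic_on S \<inter> fW -` (- {0})"
    proof (rule holomorphic_transform)
      show "(\<lambda>z. fA z / fW z) holomorphic_on S \<inter> fW -` (- {0})"
        by (intro holomorphic_intros holomorphic_on_subset[OF holA] holomorphic_on_subset[OF holW]) auto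
      show "fA x / fW x = H x" if "x \<in> S \<inter> fW -` (- {0})" for x
        using that 0 True by (cases "x = z") (auto simp: fA_def fW_def H_def)
    qed
    moreover have "z \<in> S \<inter> fW -` (- {0})"
      using z 0 by (auto simp: fW_def)
    ultimately show ?thesis
      using op by blast
  qed
  then have "H holomorphic_on S"
    by (meson field_differentiable_at_within holomorphic_onI holomorphic_on_imp_differentiable_at)
  moreover have "A z = W z * H z" if "z \<in> S" for z
    using zeros[OF that] by (auto simp: H_def)
  ultimately show thesis
    using that by (simp add: H_def)
qed

text \<open>Divisibility survives the limit as an inequality. On the boundary circle
  \<open>W n\<close> is bounded below and \<open>P n\<close> above independently of n, so the
  maximum principle bounds the quotient \<open>H\<close> on the whole disc by one constant. In the
  limit \<open>p\<close> vanishes at every zero of \<open>w\<close> at least to the same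
  order.\<close>

lemma quotient_limit_bound:
  fixes P W :: "nat \<Rightarrow> complex \<Rightarrow> complex"
  assumes P: "uniform_limit (cball a r) P p sequentially"
    and W: "uniform_limit (cball a r) W w sequentially"
    and "0 < r" and p: "continuous_on (cball a r) p" and w: "continuous_on (cball a r) w"
    and nz: "\<And>z. z \<in> sphere a r \<Longrightarrow> w z \<noteq> 0"
    and H: "\<exists>\<^sub>F n in sequentially. \<exists>H. H holomorphic_on cball a r \<and> (\<forall>z\<in>cball a r. P n z = W n z * H z)"
  obtains C where "C > 0" "\<And>z. z \<in> cball a r \<Longrightarrow> norm (p z) \<le> C * norm (w z)"
proof -
  have sc: "sphere a r \<subseteq> cball a r" by auto
  obtain b where b: "b > 0" "\<And>z. z \<in> sphere a r \<Longrightarrow> b \<le> norm (w z)"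
  proof -
    have "continuous_on (sphere a r) (\<lambda>z. norm (w z))"
      by (intro continuous_intros continuous_on_subset[OF w] sc)
    moreover have "sphere a r \<noteq> {}"
      using \<open>0 < r\<close> by (simp add: sphere_eq_empty)
    ultimately obtain x where "x \<in> sphere a r" "\<And>y. y \<in> sphere a r \<Longrightarrow> norm (w x) \<le> norm (w y)"
      using continuous_attains_inf[of "sphere a r" "\<lambda>z. norm (w z)"] by auto
    then show thesis using nz that[of "norm (w x)"] by auto
  qed
  have "bounded (p ` cball a r)"
    using compact_imp_bounded[OF compact_continuous_image[OF p compact_cball]] .
  then obtain B where B: "\<And>z. z \<in> cball a r \<Longrightarrow> norm (p z) \<le> B"
    unfolding bounded_iff by blast
  have "0 \<le> B"
    using B[of a] \<open>0 < r\<close> order_trans[OF norm_ge_zero[of "p a"]] by simp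
  \<comment> \<open>Eventually |P n| \<le> B + 1 on the disc and |W n| \<ge> b/2 on the circle, so
    \<open>C\<close> bounds the quotient on the circle.\<close>
  define C where "C = (B + 1) / (b / 2)"
  have "C > 0" using \<open>0 \<le> B\<close> \<open>b > 0\<close> by (simp add: C_def)
  have ev: "\<forall>\<^sub>F n in sequentially. (\<forall>z\<in>cball a r. dist (P n z) (p z) < 1) \<and> (\<forall>z\<in>cball a r. dist (W n z) (w z) < b/2)"
    using uniform_limitD[OF P, of 1] uniform_limitD[OF W, of "b/2"] \<open>b > 0\<close>
    by (auto intro: eventually_conj)
  have freq: "\<exists>\<^sub>F n in sequentially. \<forall>z\<in>cball a r. norm (P n z) \<le> C * norm (W n z)"
  proof (rule frequently_elim1[OF frequently_eventually_conj[OF H ev]], elim conjE exE)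
    fix n H
    assume H: "H holomorphic_on cball a r" and PWH: "\<forall>z\<in>cball a r. P n z = W n z * H z"
      and dP: "\<forall>z\<in>cball a r. dist (P n z) (p z) < 1" and dW: "\<forall>z\<in>cball a r. dist (W n z) (w z) < b/2"
    have Hb: "norm (H z) \<le> C" if "z \<in> sphere a r" for z
    proof -
      have z: "z \<in> cball a r" using that by auto
      have "norm (P n z) \<le> B + 1"
        using dP B[OF z] z norm_triangle_sub[of "P n z" "p z"] by (force simp: dist_norm)
      moreover have "norm (W n z) \<ge> b/2"
        using dW b(2)[OF that] z norm_triangle_sub[of "w z" "W n z"] by (force simp: dist_norm norm_minus_commute)
      moreover have "norm (P n z) = norm (W n z) * norm (H z)"
        using PWH z by (simp add: norm_mult)
      ultimately have "b/2 * norm (H z) \<le> B + 1"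
        by (smt (verit, best) mult_right_mono norm_ge_zero)
      then show ?thesis using \<open>b > 0\<close> by (simp add: C_def field_simps)
    qed
    have "norm (H z) \<le> C" if "z \<in> cball a r" for z
    proof (rule maximum_modulus_frontier[of H "cball a r"])
      show "H holomorphic_on interior (cball a r)"
        using H holomorphic_on_subset interior_subset by blast
      show "continuous_on (closure (cball a r)) H"
        using H by (simp add: holomorphic_on_imp_continuous_on)
    qed (use Hb that in auto)
    then show "\<forall>z\<in>cball a r. norm (P n z) \<le> C * norm (W n z)"
      using PWH by (auto simp: norm_mult mult.commute[of C] intro: mult_left_mono)
  qed
  have "norm (p z) \<le> C * norm (w z)" if z: "z \<in> cball a r" for z
  proof (rule ccontr)
    assume "\<not> norm (p z) \<le> C * norm (w z)"
    moreover have "(\<lambda>n. norm (P n z) - C * norm (W n z)) \<longlonglongrightarrow> norm (p z) - C * norm (w z)"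
      by (intro tendsto_intros tendsto_uniform_limitI[OF P z] tendsto_uniform_limitI[OF W z])
    ultimately have "\<forall>\<^sub>F n in sequentially. norm (P n z) - C * norm (W n z) > 0"
      by (intro order_tendstoD(1)) auto
    then show False
      using frequently_eventually_conj[OF freq] z by (force dest: frequently_ex)
  qed
  then show thesis using that \<open>C > 0\<close> by blast
qed

section \<open>Locally uniform convergence on the plane\<close>

text \<open>Holomorphy of \<open>f n\<close> is asked on each disc only from some index on, because
  the rescaled functions are controlled only on discs whose radius grows with n.\<close>

definition entire_limit :: "(nat \<Rightarrow> complex \<Rightarrow> complex) \<Rightarrow> (complex \<Rightarrow> complex) \<Rightarrow> bool" where
  "entire_limit f g \<longleftrightarrow> g holomorphic_on UNIV \<and>
     (\<forall>R. (\<forall>\<^sub>F n in sequentially. f n holomorphic_on ball 0 R) \<and> uniform_limit (ball 0 R) f g sequentially)"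

lemma entire_limit_bounded_image:
  assumes "g holomorphic_on UNIV"
  shows "bounded (g ` ball (0::complex) R)"
proof -
  have "compact (g ` cball 0 R)"
    by (intro compact_continuous_image holomorphic_on_imp_continuous_on
        holomorphic_on_subset[OF assms]) auto
  then show ?thesis
    by (meson ball_subset_cball bounded_subset compact_imp_bounded image_mono)
qed

lemma entire_limit_mult:
  assumes f: "entire_limit f g" and f': "entire_limit f' g'"
  shows "entire_limit (\<lambda>n z. f n z * f' n z) (\<lambda>z. g z * g' z)"
  unfolding entire_limit_def
proof (intro conjI allI)
  have g: "g holomorphic_on UNIV" "g' holomorphic_on UNIV"
    using f f' by (auto simp: entire_limit_def)
  then show "(\<lambda>z. g z * g' z) holomorphic_on UNIV"
    by (intro holomorphic_intros)
  fix R
  have "\<forall>\<^sub>F n in sequentially. f n holomorphic_on ball 0 R" "\<forall>\<^sub>F n in sequentially. f' n holomorphic_on ball 0 R"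
    using f f' by (auto simp: entire_limit_def)
  then show "\<forall>\<^sub>F n in sequentially. (\<lambda>z. f n z * f' n z) holomorphic_on ball 0 R"
    by (rule eventually_elim2) (rule holomorphic_on_mult)
  show "uniform_limit (ball 0 R) (\<lambda>n z. f n z * f' n z) (\<lambda>z. g z * g' z) sequentially"
    using f f' by (intro uniform_lim_mult entire_limit_bounded_image g) (auto simp: entire_limit_def)
qed

lemma entire_limit_add:
  assumes f: "entire_limit f g" and f': "entire_limit f' g'"
  shows "entire_limit (\<lambda>n z. f n z + f' n z) (\<lambda>z. g z + g' z)"
  unfolding entire_limit_def
proof (intro conjI allI)
  show "(\<lambda>z. g z + g' z) holomorphic_on UNIV"
    using f f' by (intro holomorphic_intros) (auto simp: entire_limit_def)
  fix R
  have "\<forall>\<^sub>F n in sequentially. f n holomorphic_on ball 0 R" "\<forall>\<^sub>F n in sequentially. f' n holomorphic_on ball 0 R"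
    using f f' by (auto simp: entire_limit_def)
  then show "\<forall>\<^sub>F n in sequentially. (\<lambda>z. f n z + f' n z) holomorphic_on ball 0 R"
    by (rule eventually_elim2) (rule holomorphic_on_add)
  show "uniform_limit (ball 0 R) (\<lambda>n z. f n z + f' n z) (\<lambda>z. g z + g' z) sequentially"
    using f f' by (intro uniform_limit_add) (auto simp: entire_limit_def)
qed

lemma entire_limit_diff:
  assumes f: "entire_limit f g" and f': "entire_limit f' g'"
  shows "entire_limit (\<lambda>n z. f n z - f' n z) (\<lambda>z. g z - g' z)"
  unfolding entire_limit_def
proof (intro conjI allI)
  show "(\<lambda>z. g z - g' z) holomorphic_on UNIV"
    using f f' by (intro holomorphic_intros) (auto simp: entire_limit_def)
  fix R
  have "\<forall>\<^sub>F n in sequentially. f n holomorphic_on ball 0 R" "\<forall>\<^sub>F n in sequentially. f' n holomorphic_on ball 0 R"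
    using f f' by (auto simp: entire_limit_def)
  then show "\<forall>\<^sub>F n in sequentially. (\<lambda>z. f n z - f' n z) holomorphic_on ball 0 R"
    by (rule eventually_elim2) (rule holomorphic_on_diff)
  show "uniform_limit (ball 0 R) (\<lambda>n z. f n z - f' n z) (\<lambda>z. g z - g' z) sequentially"
    using f f' by (intro uniform_limit_minus) (auto simp: entire_limit_def)
qed

lemma entire_limit_const: "entire_limit (\<lambda>n z. c) (\<lambda>z. c)"
  by (auto simp: entire_limit_def intro: uniform_limit_const)

text \<open>Cauchy's inequality on the unit disc about each point controls the derivative of the
  difference, whence the passage from radius R to \<open>R + 2\<close>.\<close>

lemma entire_limit_deriv:
  assumes "entire_limit f g"
  shows "entire_limit (\<lambda>n. deriv (f n)) (deriv g)"
  unfolding entire_limit_def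
proof (intro conjI allI)
  have g: "g holomorphic_on UNIV"
    and f: "\<And>R. \<forall>\<^sub>F n in sequentially. f n holomorphic_on ball 0 R"
    and lim: "\<And>R. uniform_limit (ball 0 R) f g sequentially"
    using assms by (auto simp: entire_limit_def)
  show "deriv g holomorphic_on UNIV"
    using g holomorphic_deriv by blast
  fix R
  show "\<forall>\<^sub>F n in sequentially. deriv (f n) holomorphic_on ball 0 R"
    using f[of R] by (rule eventually_mono) (auto intro: holomorphic_deriv)
  show "uniform_limit (ball 0 R) (\<lambda>n. deriv (f n)) (deriv g) sequentially"
  proof (rule uniform_limitI)
    fix e :: real assume "e > 0"
    have "\<forall>\<^sub>F n in sequentially. f n holomorphic_on ball 0 (R+2) \<and> (\<forall>z\<in>ball 0 (R+2). dist (f n z) (g z) < e/2)"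
      using f[of "R+2"] uniform_limitD[OF lim[of "R+2"], of "e/2"] \<open>e > 0\<close> by (auto intro: eventually_conj)
    then show "\<forall>\<^sub>F n in sequentially. \<forall>z\<in>ball 0 R. dist (deriv (f n) z) (deriv g z) < e"
    proof (rule eventually_mono, safe)
      fix n z
      assume hol: "f n holomorphic_on ball 0 (R+2)" and d: "\<forall>z\<in>ball 0 (R+2). dist (f n z) (g z) < e/2"
        and z: "z \<in> ball (0::complex) R"
      have sub: "cball z 1 \<subseteq> ball 0 (R+2)"
      proof
        fix x assume "x \<in> cball z 1"
        then show "x \<in> ball 0 (R+2)"
          using z norm_triangle_sub[of x z] by (simp add: dist_norm norm_minus_commute)
      qed
      have zin: "z \<in> ball 0 (R+2)" using z by auto
      have h: "(\<lambda>x. f n x - g x) holomorphic_on ball 0 (R+2)"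
        by (intro holomorphic_intros hol holomorphic_on_subset[OF g]) auto
      have "norm ((deriv ^^ 1) (\<lambda>x. f n x - g x) z) \<le> fact 1 * (e/2) / 1 ^ 1"
      proof (rule Cauchy_inequality)
        show "(\<lambda>x. f n x - g x) holomorphic_on ball z 1"
          using h sub ball_subset_cball holomorphic_on_subset by blast
        show "continuous_on (cball z 1) (\<lambda>x. f n x - g x)"
          using h sub holomorphic_on_imp_continuous_on holomorphic_on_subset by blast
        show "norm (f n x - g x) \<le> e/2" if "norm (z - x) = 1" for x
        proof -
          have "x \<in> cball z 1" using that by (simp add: dist_norm)
          then have "x \<in> ball 0 (R+2)" using sub by blast
          then show ?thesis using d by (auto simp: dist_norm intro: less_imp_le)
        qed
      qed auto
      moreover have "deriv (\<lambda>x. f n x - g x) z = deriv (f n) z - deriv g z"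
        using hol g zin
        by (intro deriv_diff) (auto intro: holomorphic_on_imp_differentiable_at)
      ultimately show "dist (deriv (f n) z) (deriv g z) < e"
        using \<open>e > 0\<close> by (simp add: dist_norm)
    qed
  qed
qed

lemma entire_limit_cball:
  assumes "entire_limit f g"
  shows "uniform_limit (cball a r) f g sequentially" "\<forall>\<^sub>F n in sequentially. f n holomorphic_on cball a r"
    "continuous_on (cball a r) g"
proof -
  have sub: "cball a r \<subseteq> ball 0 (norm a + \<bar>r\<bar> + 1)"
  proof
    fix x assume "x \<in> cball a r"
    then have "norm (x - a) \<le> \<bar>r\<bar>" by (simp add: dist_norm norm_minus_commute)
    then show "x \<in> ball 0 (norm a + \<bar>r\<bar> + 1)"
      using norm_triangle_sub[of x a] by simp
  qed
  have f: "\<forall>\<^sub>F n in sequentially. f n holomorphic_on ball 0 (norm a + \<bar>r\<bar> + 1)"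
    and lim: "uniform_limit (ball 0 (norm a + \<bar>r\<bar> + 1)) f g sequentially"
    and g: "g holomorphic_on UNIV"
    using assms by (auto simp: entire_limit_def)
  show "uniform_limit (cball a r) f g sequentially"
    using lim sub by (rule uniform_limit_on_subset)
  show "\<forall>\<^sub>F n in sequentially. f n holomorphic_on cball a r"
    using f by (rule eventually_mono) (rule holomorphic_on_subset[OF _ sub])
  show "continuous_on (cball a r) g"
    by (intro holomorphic_on_imp_continuous_on holomorphic_on_subset[OF g]) auto
qed

lemma isolated_zero_entire:
  assumes "a holomorphic_on UNIV" "a x = (0::complex)" "a y \<noteq> 0" "0 < e"
  obtains r where "0 < r" "r < e" "\<And>z. z \<in> cball x r - {x} \<Longrightarrow> a z \<noteq> 0"
proof -
  obtain r where r: "0 < r" "\<And>z. z \<in> ball x r - {x} \<Longrightarrow> a z \<noteq> 0"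
    using isolated_zeros[of a UNIV x y] assms by auto
  show thesis
  proof (rule that[of "min (r/2) (e/2)"])
    show "a z \<noteq> 0" if "z \<in> cball x (min (r/2) (e/2)) - {x}" for z
      by (rule r(2)) (use that r(1) in auto)
  qed (use r assms in auto)
qed

text \<open>Zeros of \<open>a\<close> attract zeros of \<open>A n\<close>, where \<open>Q n\<close>
  is small. If \<open>q x\<close> were nonzero, \<open>A n\<close> would be zero-free near
  \<open>x\<close>, so 1 would be a holomorphic multiple of \<open>A n\<close>, and
  \<open>quotient_limit_bound\<close> with numerator 1 would give 1 \<le> C |a x| = 0.\<close>

lemma Hurwitz_transfer:
  assumes A: "entire_limit A a" and Q: "entire_limit Q q"
    and "a x = 0" "a y \<noteq> 0"
    and \<epsilon>: "\<epsilon> \<longlonglongrightarrow> (0::real)"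
    and AQ: "\<And>R. \<forall>\<^sub>F n in sequentially. \<forall>z\<in>ball 0 R. A n z = 0 \<longrightarrow> norm (Q n z) \<le> \<epsilon> n"
  shows "q x = 0"
proof (rule ccontr)
  assume "q x \<noteq> 0"
  define d where "d = norm (q x) / 2"
  have "d > 0" using \<open>q x \<noteq> 0\<close> by (simp add: d_def)
  have hol: "a holomorphic_on UNIV" "q holomorphic_on UNIV"
    using A Q by (auto simp: entire_limit_def)
  have "isCont q x"
    using hol(2) by (simp add: holomorphic_on_imp_differentiable_at field_differentiable_imp_continuous_at)
  then obtain e where e: "e > 0" "\<And>z. dist z x < e \<Longrightarrow> dist (q z) (q x) < d"
    using \<open>d > 0\<close> by (auto simp: continuous_at_eps_delta)
  obtain r where r: "0 < r" "r < e" "\<And>z. z \<in> cball x r - {x} \<Longrightarrow> a z \<noteq> 0"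
    using isolated_zero_entire[OF hol(1) assms(3,4) \<open>e > 0\<close>] by blast
  have qd: "norm (q z) > d" if "z \<in> cball x r" for z
  proof -
    have "dist (q z) (q x) < d"
      using that r(2) by (intro e(2)) (auto simp: dist_commute)
    then show ?thesis
      using norm_triangle_sub[of "q x" "q z"] by (simp add: d_def dist_norm norm_minus_commute)
  qed
  have sub: "cball x r \<subseteq> ball 0 (norm x + r + 1)"
  proof
    fix z assume "z \<in> cball x r"
    then show "z \<in> ball 0 (norm x + r + 1)"
      using norm_triangle_sub[of z x] by (simp add: dist_norm norm_minus_commute)
  qed
  have "d/2 > 0" using \<open>d > 0\<close> by simp
  have "\<forall>\<^sub>F n in sequentially. A n holomorphic_on cball x r \<and> (\<forall>z\<in>cball x r. dist (Q n z) (q z) < d/2)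
      \<and> \<epsilon> n < d/2 \<and> (\<forall>z\<in>ball 0 (norm x + r + 1). A n z = 0 \<longrightarrow> norm (Q n z) \<le> \<epsilon> n)"
    by (intro eventually_conj entire_limit_cball(2)[OF A] AQ
        uniform_limitD[OF entire_limit_cball(1)[OF Q] \<open>d/2 > 0\<close>] order_tendstoD(2)[OF \<epsilon> \<open>d/2 > 0\<close>])
  then have "\<forall>\<^sub>F n in sequentially. \<exists>H. H holomorphic_on cball x r \<and> (\<forall>z\<in>cball x r. 1 = A n z * H z)"
  proof (rule eventually_mono, elim conjE)
    fix n
    assume hA: "A n holomorphic_on cball x r" and dQ: "\<forall>z\<in>cball x r. dist (Q n z) (q z) < d/2"
      and "\<epsilon> n < d/2" and small: "\<forall>z\<in>ball 0 (norm x + r + 1). A n z = 0 \<longrightarrow> norm (Q n z) \<le> \<epsilon> n"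
    have "A n z \<noteq> 0" if z: "z \<in> cball x r" for z
    proof
      assume "A n z = 0"
      then have "norm (Q n z) < d/2"
        using small subsetD[OF sub z] \<open>\<epsilon> n < d/2\<close> by fastforce
      moreover have "dist (Q n z) (q z) < d/2" using dQ z by blast
      ultimately show False
        using qd[OF z] norm_triangle_sub[of "q z" "Q n z"] by (simp add: dist_norm norm_minus_commute)
    qed
    then show "\<exists>H. H holomorphic_on cball x r \<and> (\<forall>z\<in>cball x r. 1 = A n z * H z)"
      by (intro exI[of _ "\<lambda>z. 1 / A n z"]) (auto intro!: holomorphic_intros hA)
  qed
  then have fr: "\<exists>\<^sub>F n in sequentially. \<exists>H. H holomorphic_on cball x r \<and> (\<forall>z\<in>cball x r. (\<lambda>n z. 1) n z = A n z * H z)"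
    by (simp add: eventually_frequently)
  obtain C where "\<And>z. z \<in> cball x r \<Longrightarrow> norm (1::complex) \<le> C * norm (a z)"
  proof (rule quotient_limit_bound[OF uniform_limit_const entire_limit_cball(1)[OF A] \<open>0 < r\<close> _
        entire_limit_cball(3)[OF A] _ fr])
    show "a z \<noteq> 0" if "z \<in> sphere x r" for z
      using r that by auto
  qed auto
  from this[of x] show False
    using \<open>a x = 0\<close> \<open>0 < r\<close> by simp
qed

section \<open>Marty's criterion\<close>

text \<open>Continuity method. By the intermediate value theorem \<open>h \<le> c\<close> up to the
  first time at which \<open>h\<close> reaches \<open>c\<close>; there \<open>step\<close> applies
  and gives a contradiction.\<close>

lemma continuous_bound_propagates:
  fixes h :: "real \<Rightarrow> real"
  assumes cont: "continuous_on {0..1} h" and "h 0 < c"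
    and step: "\<And>t. t \<in> {0..1} \<Longrightarrow> (\<And>s. s \<in> {0..t} \<Longrightarrow> h s \<le> c) \<Longrightarrow> h t < c"
    and "t \<in> {0..1}"
  shows "h t < c"
proof (rule ccontr)
  assume "\<not> h t < c"
  define T where "T = {0..1} \<inter> h -` {c..}"
  have "T \<noteq> {}" using \<open>\<not> h t < c\<close> \<open>t \<in> {0..1}\<close> by (auto simp: T_def)
  have "closed T"
    unfolding T_def by (intro continuous_closed_preimage cont) auto
  then have "compact T"
    using compact_Int_closed[of "{0..1::real}" T] by (simp add: T_def inf.absorb2)
  then obtain s where s: "s \<in> T" "\<And>t. t \<in> T \<Longrightarrow> s \<le> t"
    using compact_attains_inf[OF _ \<open>T \<noteq> {}\<close>] by blast
  have s01: "0 \<le> s" "s \<le> 1" and hs: "h s \<ge> c" using s(1) by (auto simp: T_def)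
  have "h s' \<le> c" if s': "s' \<in> {0..s}" for s'
  proof (rule ccontr)
    assume "\<not> h s' \<le> c"
    then obtain y where y: "0 \<le> y" "y \<le> s'" "h y = c"
      using IVT'[of h 0 c s'] \<open>h 0 < c\<close> s' s01 continuous_on_subset[OF cont, of "{0..s'}"] by auto
    then have "y \<in> T" using s' s01 by (auto simp: T_def)
    then have "s \<le> y" by (rule s(2))
    then have "y = s'" using y s' by auto
    then show False using y \<open>\<not> h s' \<le> c\<close> by auto
  qed
  then have "h s < c"
    using s01 by (intro step) auto
  then show False using hs by simp
qed

text \<open>Instead of equicontinuity in the chordal metric, the proof of Marty's criterion uses that either
  the function or its reciprocal is bounded on a disc whose radius depends on the constant only.\<close>

lemma spherical_bound_propagates_small:
  assumes hol: "f holomorphic_on ball x d" and "C > 0" "5 * C * d \<le> 1"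
    and bd: "\<And>z. z \<in> ball x d \<Longrightarrow> norm (deriv f z) \<le> C * (1 + (norm (f z))\<^sup>2)"
    and "norm (f x) \<le> 1" "y \<in> ball x d"
  shows "norm (f y) < 2"
proof -
  define p where "p = (\<lambda>t. x + of_real t * (y - x))"
  have dist_p: "norm (p t - x) \<le> norm (y - x)" if "t \<in> {0..1}" for t
    using that by (auto simp: p_def norm_mult intro: mult_left_le_one_le)
  have p_in: "p t \<in> ball x d" if "t \<in> {0..1}" for t
    using dist_p[OF that] \<open>y \<in> ball x d\<close> by (auto simp: dist_norm norm_minus_commute)
  have "norm (f (p 1)) < 2"
  proof (rule continuous_bound_propagates[of "\<lambda>t. norm (f (p t))"])
    show "continuous_on {0..1} (\<lambda>t. norm (f (p t)))"
      using p_in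
      by (intro continuous_intros continuous_on_compose2[OF holomorphic_on_imp_continuous_on[OF hol]])
        (auto simp: p_def intro!: continuous_intros)
    show "norm (f (p 0)) < 2" using \<open>norm (f x) \<le> 1\<close> by (simp add: p_def)
    fix t :: real assume t: "t \<in> {0..1}" and le: "\<And>s. s \<in> {0..t} \<Longrightarrow> norm (f (p s)) \<le> 2"
    have seg: "\<exists>s\<in>{0..t}. z = p s" if z: "z \<in> closed_segment x (p t)" for z
    proof -
      obtain u where u: "0 \<le> u" "u \<le> 1" "z = (1 - u) *\<^sub>R x + u *\<^sub>R p t"
        using z by (auto simp: closed_segment_def)
      then show ?thesis
        using t by (intro bexI[of _ "u * t"])
          (auto simp: p_def scaleR_conv_of_real algebra_simps intro: mult_left_le)
    qed
    have "norm (f (p t) - f x) \<le> (5 * C) * norm (p t - x)"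
    proof (rule field_differentiable_bound[OF convex_closed_segment[of x "p t"]])
      fix z assume "z \<in> closed_segment x (p t)"
      then obtain s where s: "s \<in> {0..t}" "z = p s" using seg by blast
      then have z: "z \<in> ball x d" using p_in t by auto
      show "(f has_field_derivative deriv f z) (at z within closed_segment x (p t))"
        using hol z by (meson open_ball DERIV_subset holomorphic_derivI subset_UNIV)
      \<comment> \<open>The factor 5 is \<open>1 + 2\<^sup>2\<close>, since |f| \<le> 2 along the
        segment; \<open>5 * C * d \<le> 1\<close> then keeps the growth of |f| below 1.\<close>
      have "(norm (f z))\<^sup>2 \<le> 2\<^sup>2" using le s by (intro power_mono) auto
      then have "C * (1 + (norm (f z))\<^sup>2) \<le> C * 5"
        using \<open>C > 0\<close> by (intro mult_left_mono) auto
      then show "norm (deriv f z) \<le> 5 * C"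
        using bd[OF z] by simp
    qed auto
    also have "\<dots> < 5 * C * d"
      using p_in[OF t] \<open>C > 0\<close> by (intro mult_strict_left_mono) (auto simp: dist_norm norm_minus_commute)
    finally show "norm (f (p t)) < 2"
      using \<open>norm (f x) \<le> 1\<close> \<open>5 * C * d \<le> 1\<close> norm_triangle_sub[of "f (p t)" "f x"] by simp
  qed auto
  then show ?thesis by (simp add: p_def)
qed

lemma spherical_bound_propagates_large:
  assumes hol: "f holomorphic_on ball x d" and "C > 0" "5 * C * d \<le> 1"
    and bd: "\<And>z. z \<in> ball x d \<Longrightarrow> norm (deriv f z) \<le> C * (1 + (norm (f z))\<^sup>2)"
    and "norm (f x) \<ge> 1" "y \<in> ball x d"
  shows "norm (f y) > 1/2"
proof -
  define p where "p = (\<lambda>t. x + of_real t * (y - x))"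
  have dist_p: "norm (p t - x) \<le> norm (y - x)" if "t \<in> {0..1}" for t
    using that by (auto simp: p_def norm_mult intro: mult_left_le_one_le)
  have p_in: "p t \<in> ball x d" if "t \<in> {0..1}" for t
    using dist_p[OF that] \<open>y \<in> ball x d\<close> by (auto simp: dist_norm norm_minus_commute)
  \<comment> \<open>The small case cannot be applied to 1/f, which is not known to be pole-free on
    the disc. Running the continuity argument on -|f| keeps |f| \<ge> 1/2 up to time t, so that 1/f
    is differentiable along the segment, again with derivative at most 5C.\<close>
  have "- norm (f (p 1)) < -(1/2)"
  proof (rule continuous_bound_propagates[of "\<lambda>t. - norm (f (p t))"])
    show "continuous_on {0..1} (\<lambda>t. - norm (f (p t)))"
      using p_in
      by (intro continuous_intros continuous_on_compose2[OF holomorphic_on_imp_continuous_on[OF hol]])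
        (auto simp: p_def intro!: continuous_intros)
    show "- norm (f (p 0)) < -(1/2)" using \<open>norm (f x) \<ge> 1\<close> by (simp add: p_def)
    fix t :: real assume t: "t \<in> {0..1}" and le: "\<And>s. s \<in> {0..t} \<Longrightarrow> - norm (f (p s)) \<le> -(1/2)"
    have seg: "\<exists>s\<in>{0..t}. z = p s" if z: "z \<in> closed_segment x (p t)" for z
    proof -
      obtain u where u: "0 \<le> u" "u \<le> 1" "z = (1 - u) *\<^sub>R x + u *\<^sub>R p t"
        using z by (auto simp: closed_segment_def)
      then show ?thesis
        using t by (intro bexI[of _ "u * t"])
          (auto simp: p_def scaleR_conv_of_real algebra_simps intro: mult_left_le)
    qed
    have "norm (inverse (f (p t)) - inverse (f x)) \<le> (5 * C) * norm (p t - x)"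
    proof (rule field_differentiable_bound[OF convex_closed_segment[of x "p t"]])
      fix z assume "z \<in> closed_segment x (p t)"
      then obtain s where s: "s \<in> {0..t}" "z = p s" using seg by blast
      then have z: "z \<in> ball x d" using p_in t by auto
      have big: "norm (f z) \<ge> 1/2" using le[OF s(1)] s by simp
      then have nz: "f z \<noteq> 0" by auto
      have "(f has_field_derivative deriv f z) (at z within closed_segment x (p t))"
        using hol z by (meson open_ball DERIV_subset holomorphic_derivI subset_UNIV)
      from DERIV_inverse'[OF this nz]
      show "((\<lambda>z. inverse (f z)) has_field_derivative - (inverse (f z) * deriv f z * inverse (f z)))
          (at z within closed_segment x (p t))" .
      have "(1/2)\<^sup>2 \<le> (norm (f z))\<^sup>2" using big by (intro power_mono) auto
      then have "1 \<le> 4 * (norm (f z))\<^sup>2" by (simp add: power2_eq_square)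
      then have "C * (1 + (norm (f z))\<^sup>2) \<le> C * (5 * (norm (f z))\<^sup>2)"
        using \<open>C > 0\<close> by (intro mult_left_mono) auto
      then have le: "norm (deriv f z) \<le> 5 * C * (norm (f z))\<^sup>2"
        using bd[OF z] by simp
      have "norm (- (inverse (f z) * deriv f z * inverse (f z))) = norm (deriv f z) / (norm (f z))\<^sup>2"
        by (simp add: norm_mult norm_inverse power2_eq_square divide_inverse)
      also have "\<dots> \<le> 5 * C"
        using le nz by (subst pos_divide_le_eq) auto
      finally show "norm (- (inverse (f z) * deriv f z * inverse (f z))) \<le> 5 * C" .
    qed auto
    also have "\<dots> < 5 * C * d"
      using p_in[OF t] \<open>C > 0\<close> by (intro mult_strict_left_mono) (auto simp: dist_norm norm_minus_commute)
    finally have "norm (inverse (f (p t))) < 1 + norm (inverse (f x))"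
      using \<open>5 * C * d \<le> 1\<close> norm_triangle_sub[of "inverse (f (p t))" "inverse (f x)"] by simp
    moreover have "norm (inverse (f x)) \<le> 1"
      using \<open>norm (f x) \<ge> 1\<close> by (simp add: norm_inverse inverse_le_1_iff)
    ultimately have "inverse (norm (f (p t))) < 2" by (simp add: norm_inverse)
    moreover have "norm (f (p t)) > 0" using le[of t] t by auto
    ultimately show "- norm (f (p t)) < -(1/2)" by (simp add: field_simps)
  qed auto
  then show ?thesis by (simp add: p_def)
qed

section \<open>Normality from local spherical bounds\<close>

text \<open>Convergence of holomorphic functions to a holomorphic limit or to infinity, kept in
  Euclidean terms; the chordal metric enters only in \<open>normal_family_onI\<close>.\<close>

definition spherical_convergent_on :: "complex set \<Rightarrow> (nat \<Rightarrow> complex \<Rightarrow> complex) \<Rightarrow> bool" where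
  "spherical_convergent_on U F \<longleftrightarrow>
     (\<exists>g. g holomorphic_on U \<and> uniform_limit U F g sequentially) \<or>
     (\<forall>B. \<forall>\<^sub>F n in sequentially. \<forall>z\<in>U. B \<le> norm (F n z))"

text \<open>A bound on the spherical derivative |f'|/(1 + |f|^2), cleared of the
  denominator.\<close>

definition spherical_bounded_on :: "complex set \<Rightarrow> real \<Rightarrow> (complex \<Rightarrow> complex) \<Rightarrow> bool" where
  "spherical_bounded_on U C f \<longleftrightarrow>
     f holomorphic_on U \<and> (\<forall>z\<in>U. norm (deriv f z) \<le> C * (1 + (norm (f z))\<^sup>2))"

text \<open>The radius \<open>d\<close> is obtained before the sequence, so that one countable cover
  serves all subsequences. Infinitely many terms satisfy |F n x| \<le> 1 or infinitely many satisfy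
  |F n x| \<ge> 1. In the first case the functions, in the second their reciprocals, are bounded by
  2 near \<open>x\<close>, and Montel's theorem applies.\<close>

lemma Marty_local:
  assumes "r > 0" "C > 0"
  obtains d where "0 < d" "d \<le> r"
    "\<And>F. (\<And>n. spherical_bounded_on (ball x r) C (F n)) \<Longrightarrow>
        \<exists>k :: nat \<Rightarrow> nat. strict_mono k \<and> spherical_convergent_on (ball x d) (F \<circ> k)"
proof -
  define e where "e = min r (1 / (5 * C))"
  have e: "e > 0" "e \<le> r" "5 * C * e \<le> 1"
    using assms by (auto simp: e_def min_def field_simps)
  have sub: "ball x e \<subseteq> ball x r" using e by auto
  have cb: "cball x (e/2) \<subseteq> ball x e" "ball x (e/2) \<subseteq> cball x (e/2)" using e by auto
  show thesis
  proof (rule that[of "e/2"])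
    fix F :: "nat \<Rightarrow> complex \<Rightarrow> complex"
    assume F: "\<And>n. spherical_bounded_on (ball x r) C (F n)"
    have hol: "F n holomorphic_on ball x e" for n
      using F[of n] sub by (auto simp: spherical_bounded_on_def intro: holomorphic_on_subset)
    have bd: "norm (deriv (F n) z) \<le> C * (1 + (norm (F n z))\<^sup>2)" if "z \<in> ball x e" for n z
      using F[of n] sub that by (auto simp: spherical_bounded_on_def)
    have "{n. norm (F n x) \<le> 1} \<union> {n. norm (F n x) \<ge> 1} = UNIV" by auto
    then have "infinite {n. norm (F n x) \<le> 1} \<or> infinite {n. norm (F n x) \<ge> 1}"
      by (metis finite_Un infinite_UNIV_nat)
    then show "\<exists>k :: nat \<Rightarrow> nat. strict_mono k \<and> spherical_convergent_on (ball x (e/2)) (F \<circ> k)"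
    proof
      assume "infinite {n. norm (F n x) \<le> 1}"
      then obtain k :: "nat \<Rightarrow> nat" where k: "strict_mono k" "\<And>n. norm (F (k n) x) \<le> 1"
        using infinite_enumerate[of "{n. norm (F n x) \<le> 1}"] by auto
      have b2: "norm (F (k n) z) \<le> 2" if "z \<in> ball x e" for n z
        using spherical_bound_propagates_small[OF hol \<open>C > 0\<close> e(3) bd k(2) that] by (simp add: less_imp_le)
      obtain g l where g: "g holomorphic_on ball x e" and l: "strict_mono (l :: nat \<Rightarrow> nat)"
        and lim: "\<And>K. compact K \<Longrightarrow> K \<subseteq> ball x e \<Longrightarrow> uniform_limit K ((F \<circ> k) \<circ> l) g sequentially"
      proof (rule Montel[of "ball x e" "range (F \<circ> k)" "F \<circ> k"])
        show "h holomorphic_on ball x e" if "h \<in> range (F \<circ> k)" for h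
          using that hol by auto
        show "\<exists>B. \<forall>h\<in>range (F \<circ> k). \<forall>z\<in>K. norm (h z) \<le> B" if "K \<subseteq> ball x e" for K
          using that b2 by (intro exI[of _ 2]) auto
      qed auto
      have "uniform_limit (ball x (e/2)) (F \<circ> (k \<circ> l)) g sequentially"
        using lim[of "cball x (e/2)"] cb by (auto simp: o_assoc intro: uniform_limit_on_subset)
      moreover have "g holomorphic_on ball x (e/2)"
        using g cb holomorphic_on_subset by blast
      ultimately show ?thesis
        using strict_mono_o[OF k(1) l] unfolding spherical_convergent_on_def by blast
    next
      assume "infinite {n. norm (F n x) \<ge> 1}"
      then obtain k :: "nat \<Rightarrow> nat" where k: "strict_mono k" "\<And>n. norm (F (k n) x) \<ge> 1"
        using infinite_enumerate[of "{n. norm (F n x) \<ge> 1}"] by auto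
      have b2: "norm (F (k n) z) > 1/2" if "z \<in> ball x e" for n z
        using spherical_bound_propagates_large[OF hol \<open>C > 0\<close> e(3) bd k(2) that] .
      have nz: "F (k n) z \<noteq> 0" if "z \<in> ball x e" for n z
        using b2[OF that, of n] by auto
      define G where "G = (\<lambda>n z. inverse (F (k n) z))"
      have holG: "G n holomorphic_on ball x e" for n
        unfolding G_def by (intro holomorphic_intros hol nz) auto
      have G2: "norm (G n z) \<le> 2" if "z \<in> ball x e" for n z
        using b2[OF that, of n] le_imp_inverse_le[of "1/2" "norm (F (k n) z)"] by (simp add: G_def norm_inverse)
      obtain h l where h: "h holomorphic_on ball x e" and l: "strict_mono (l :: nat \<Rightarrow> nat)"
        and lim: "\<And>K. compact K \<Longrightarrow> K \<subseteq> ball x e \<Longrightarrow> uniform_limit K (G \<circ> l) h sequentially"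
      proof (rule Montel[of "ball x e" "range G" G])
        show "\<exists>B. \<forall>h\<in>range G. \<forall>z\<in>K. norm (h z) \<le> B" if "K \<subseteq> ball x e" for K
          using that G2 by (intro exI[of _ 2]) auto
      qed (use holG in auto)
      have lim2: "uniform_limit (cball x (e/2)) (G \<circ> l) h sequentially"
        using lim[OF compact_cball cb(1)] .
      \<comment> \<open>By Hurwitz the limit \<open>h\<close> of the zero-free reciprocals vanishes
        identically or nowhere: in the first case \<open>F\<close> tends to infinity along the
        subsequence, in the second it converges to 1/h.\<close>
      have "spherical_convergent_on (ball x (e/2)) (F \<circ> (k \<circ> l))"
      proof (cases "\<exists>z\<in>ball x e. h z = 0")
        case True
        then obtain z0 where z0: "z0 \<in> ball x e" "h z0 = 0" by blast
        have "h constant_on ball x e"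
        proof (rule ccontr)
          assume nc: "\<not> h constant_on ball x e"
          have "h z0 \<noteq> 0"
          proof (rule Hurwitz_no_zeros[of "ball x e" "G \<circ> l" h z0])
            show "(G \<circ> l) n z \<noteq> 0" if "z \<in> ball x e" for n z
              using nz[OF that] by (simp add: G_def)
            show "(G \<circ> l) n holomorphic_on ball x e" for n
              using holG by simp
          qed (use h lim nc z0 in \<open>simp_all\<close>)
          then show False using z0 by simp
        qed
        then have h0: "h z = 0" if "z \<in> ball x e" for z
          using that z0 unfolding constant_on_def by auto
        have "\<forall>\<^sub>F n in sequentially. \<forall>z\<in>ball x (e/2). B \<le> norm ((F \<circ> (k \<circ> l)) n z)" for B
        proof -
          define B' where "B' = max B 1"
          have "B' > 0" by (simp add: B'_def)
          have "\<forall>\<^sub>F n in sequentially. \<forall>z\<in>cball x (e/2). dist ((G \<circ> l) n z) (h z) < inverse B'"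
            using \<open>B' > 0\<close> by (intro uniform_limitD[OF lim2]) auto
          then show ?thesis
          proof (rule eventually_mono, safe)
            fix n z assume d: "\<forall>z\<in>cball x (e/2). dist ((G \<circ> l) n z) (h z) < inverse B'" and z: "z \<in> ball x (e/2)"
            have ze: "z \<in> ball x e" using z e by auto
            have "norm (G (l n) z) < inverse B'"
              using d[rule_format, of z] z h0[OF ze] by simp
            then have "inverse (norm (F (k (l n)) z)) < inverse B'"
              by (simp add: G_def norm_inverse)
            then have "B' < norm (F (k (l n)) z)"
              using nz[OF ze] \<open>B' > 0\<close> by simp
            then show "B \<le> norm ((F \<circ> (k \<circ> l)) n z)" by (simp add: B'_def)
          qed
        qed
        then show ?thesis by (simp add: spherical_convergent_on_def)
      next
        case False
        then have hnz: "h z \<noteq> 0" if "z \<in> ball x e" for z using that by blast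
        have "continuous_on (cball x (e/2)) (\<lambda>z. norm (h z))"
          using h cb by (intro continuous_intros holomorphic_on_imp_continuous_on) (auto intro: holomorphic_on_subset)
        moreover have "cball x (e/2) \<noteq> {}" using e by auto
        ultimately obtain w where w: "w \<in> cball x (e/2)" "\<And>z. z \<in> cball x (e/2) \<Longrightarrow> norm (h w) \<le> norm (h z)"
          using continuous_attains_inf[of "cball x (e/2)" "\<lambda>z. norm (h z)"] by auto
        have "uniform_limit (cball x (e/2)) (\<lambda>n z. inverse ((G \<circ> l) n z)) (inverse \<circ> h) sequentially"
          using w hnz[of w] cb by (intro uniform_lim_inverse[OF lim2, of "norm (h w)"]) auto
        then have "uniform_limit (ball x (e/2)) (F \<circ> (k \<circ> l)) (inverse \<circ> h) sequentially"
          using uniform_limit_on_subset[OF _ cb(2)] by (simp add: G_def o_def)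
        moreover have "inverse \<circ> h holomorphic_on ball x (e/2)"
          unfolding o_def using e hnz by (intro holomorphic_intros holomorphic_on_subset[OF h]) auto
        ultimately show ?thesis unfolding spherical_convergent_on_def by blast
      qed
      then show ?thesis
        using strict_mono_o[OF k(1) l] by blast
    qed
  qed (use e in auto)
qed

text \<open>This weak form of passing to a subsequence is what the diagonal argument asks for; it
  also allows finitely many terms to be changed.\<close>

lemma spherical_convergent_on_subseq:
  assumes "spherical_convergent_on U F" and k: "\<And>j. N \<le> j \<Longrightarrow> \<exists>i\<ge>j. G j = F i"
  shows "spherical_convergent_on U G"
proof -
  have ev: "\<forall>\<^sub>F n in sequentially. P (G n)" if PF: "\<forall>\<^sub>F n in sequentially. P (F n)" for P
  proof -
    obtain m where m: "\<forall>n\<ge>m. P (F n)"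
      using PF unfolding eventually_sequentially by blast
    have "P (G n)" if n: "n \<ge> max m N" for n
    proof -
      obtain i where "i \<ge> n" "G n = F i" using k[of n] n by auto
      then show ?thesis using m n by simp
    qed
    then show ?thesis unfolding eventually_sequentially by blast
  qed
  show ?thesis
    using assms(1) unfolding spherical_convergent_on_def uniform_limit_iff
    by (blast intro: ev[of "\<lambda>f. \<forall>x\<in>U. dist (f x) (g x) < e" for g e]
        ev[of "\<lambda>f. \<forall>z\<in>U. B \<le> norm (f z)" for B])
qed

text \<open>The bounds hold only from an index on that may depend on the point, as happens for
  rescaled functions living on growing discs. A diagonal subsequence converges on each disc of a
  countable cover, and connectedness forces the same alternative, finite or infinite limit, on all
  of them.\<close>

theorem Marty_sequence:
  fixes F :: "nat \<Rightarrow> complex \<Rightarrow> complex"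
  assumes "open \<Omega>" "connected \<Omega>" "\<Omega> \<noteq> {}"
    and loc: "\<And>x. x \<in> \<Omega> \<Longrightarrow> \<exists>r>0. \<exists>C. ball x r \<subseteq> \<Omega> \<and>
        (\<forall>\<^sub>F n in sequentially. spherical_bounded_on (ball x r) C (F n))"
  obtains k :: "nat \<Rightarrow> nat" where "strict_mono k"
    "(\<exists>g. g holomorphic_on \<Omega> \<and>
        (\<forall>K. compact K \<and> K \<subseteq> \<Omega> \<longrightarrow> uniform_limit K (F \<circ> k) g sequentially)) \<or>
     (\<forall>K B. compact K \<and> K \<subseteq> \<Omega> \<longrightarrow> (\<forall>\<^sub>F n in sequentially. \<forall>z\<in>K. B \<le> norm ((F \<circ> k) n z)))"
proof -
  define Q where "Q = (\<lambda>x (r, C, d). ball x d \<subseteq> \<Omega> \<and> 0 < d \<and> C > 0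
     \<and> (\<forall>\<^sub>F n in sequentially. spherical_bounded_on (ball x r) C (F n))
     \<and> (\<forall>G. (\<forall>n. spherical_bounded_on (ball x r) C (G n)) \<longrightarrow>
        (\<exists>k :: nat \<Rightarrow> nat. strict_mono k \<and> spherical_convergent_on (ball x d) (G \<circ> k))))"
  have "\<exists>p. Q x p" if x: "x \<in> \<Omega>" for x
  proof -
    obtain r C where r: "r > 0" "ball x r \<subseteq> \<Omega>"
      and C: "\<forall>\<^sub>F n in sequentially. spherical_bounded_on (ball x r) C (F n)"
      using loc[OF x] by blast
    have C': "\<forall>\<^sub>F n in sequentially. spherical_bounded_on (ball x r) (max C 1) (F n)"
      using C
    proof (rule eventually_mono)
      fix n assume *: "spherical_bounded_on (ball x r) C (F n)"
      have "C * (1 + (norm (F n z))\<^sup>2) \<le> max C 1 * (1 + (norm (F n z))\<^sup>2)" for z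
        by (intro mult_right_mono) auto
      then show "spherical_bounded_on (ball x r) (max C 1) (F n)"
        using * unfolding spherical_bounded_on_def by (blast intro: order_trans)
    qed
    have "max C 1 > 0" by simp
    obtain d where d: "0 < d" "d \<le> r" "\<And>F. (\<And>n. spherical_bounded_on (ball x r) (max C 1) (F n)) \<Longrightarrow>
        \<exists>k :: nat \<Rightarrow> nat. strict_mono k \<and> spherical_convergent_on (ball x d) (F \<circ> k)"
      using Marty_local[OF \<open>r > 0\<close> \<open>max C 1 > 0\<close>, of x] by blast
    have "ball x d \<subseteq> \<Omega>" using r d subset_ball by blast
    then have "Q x (r, max C 1, d)"
      unfolding Q_def prod.case using d(1) C' \<open>max C 1 > 0\<close> by (intro conjI allI impI d(3)) auto
    then show ?thesis ..
  qed
  then obtain p where p: "\<And>x. x \<in> \<Omega> \<Longrightarrow> Q x (p x)"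
    by metis
  define r C d where "r = (\<lambda>x. fst (p x))" and "C = (\<lambda>x. fst (snd (p x)))" and "d = (\<lambda>x. snd (snd (p x)))"
  have Q: "Q x (r x, C x, d x)" if "x \<in> \<Omega>" for x
    using p[OF that] by (simp add: r_def C_def d_def)
  have d: "\<And>x. x \<in> \<Omega> \<Longrightarrow> ball x (d x) \<subseteq> \<Omega>" "\<And>x. x \<in> \<Omega> \<Longrightarrow> 0 < d x"
      "\<And>x. x \<in> \<Omega> \<Longrightarrow> C x > 0"
    and ev: "\<And>x. x \<in> \<Omega> \<Longrightarrow> \<forall>\<^sub>F n in sequentially. spherical_bounded_on (ball x (r x)) (C x) (F n)"
    and ex: "\<And>x G. x \<in> \<Omega> \<Longrightarrow> (\<And>n. spherical_bounded_on (ball x (r x)) (C x) (G n)) \<Longrightarrow>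
        \<exists>k :: nat \<Rightarrow> nat. strict_mono k \<and> spherical_convergent_on (ball x (d x)) (G \<circ> k)"
    using Q unfolding Q_def prod.case by blast+
  obtain c :: "nat \<Rightarrow> complex" where c: "range c \<subseteq> \<Omega>" "(\<Union>i. ball (c i) (d (c i))) = \<Omega>"
  proof -
    obtain \<C> where C: "\<C> \<subseteq> (\<lambda>x. ball x (d x)) ` \<Omega>" "countable \<C>" "\<Union>\<C> = \<Union>((\<lambda>x. ball x (d x)) ` \<Omega>)"
      using Lindelof[of "(\<lambda>x. ball x (d x)) ` \<Omega>"] by auto
    have un: "\<Union>((\<lambda>x. ball x (d x)) ` \<Omega>) = \<Omega>"
      using d by (auto intro: centre_in_ball[THEN iffD2])
    have "\<exists>A. countable A \<and> A \<subseteq> \<Omega> \<and> \<C> = (\<lambda>x. ball x (d x)) ` A"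
      using C(1,2) by (intro countable_subset_image[THEN iffD1] conjI)
    then obtain A where A: "countable A" "A \<subseteq> \<Omega>" "\<C> = (\<lambda>x. ball x (d x)) ` A"
      by blast
    have UA: "(\<Union>x\<in>A. ball x (d x)) = \<Omega>" using C(3) un unfolding A(3) by (rule trans)
    then have "A \<noteq> {}" using \<open>\<Omega> \<noteq> {}\<close> by blast
    then have ran: "range (from_nat_into A) = A" using A(1) by (rule range_from_nat_into)
    have "(\<Union>i. ball (from_nat_into A i) (d (from_nat_into A i))) = (\<Union>x\<in>range (from_nat_into A). ball x (d x))"
      by (simp only: image_image)
    then show thesis
      using that[of "from_nat_into A"] A(2) UA unfolding ran by blast
  qed
  have c\<Omega>: "c i \<in> \<Omega>" for i using c by auto
  define good where "good = (\<lambda>i. spherical_bounded_on (ball (c i) (r (c i))) (C (c i)))"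
  \<comment> \<open>Terms that violate the bound on disc \<open>i\<close> are replaced by 0, which
    satisfies it. \<open>Marty_local\<close> and the diagonal lemma then see a sequence that is
    bounded from the start, and \<open>T i\<close> changes only finitely many terms.\<close>
  define T where "T = (\<lambda>i f. if good i f then f else (\<lambda>_. 0 :: complex))"
  have goodT: "good i (T i f)" for i f
    using d(3)[OF c\<Omega>[of i]] by (simp add: T_def good_def spherical_bounded_on_def less_imp_le)
  obtain k where k: "strict_mono k" "\<And>i. spherical_convergent_on (ball (c i) (d (c i))) (\<lambda>n. T i ((F \<circ> k) n))"
  proof (rule subsequence_diagonalization_lemma
      [of "\<lambda>i s. spherical_convergent_on (ball (c i) (d (c i))) (\<lambda>n. T i (s n))" F])
    show "\<exists>k. strict_mono k \<and> spherical_convergent_on (ball (c i) (d (c i))) (\<lambda>n. T i ((s \<circ> k) n))"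
      for i and s :: "nat \<Rightarrow> complex \<Rightarrow> complex"
      using ex[OF c\<Omega>, of i "\<lambda>n. T i (s n)"] goodT by (auto simp: good_def o_def)
    show "spherical_convergent_on (ball (c i) (d (c i))) (\<lambda>n. T i ((s \<circ> k2) n))"
      if "spherical_convergent_on (ball (c i) (d (c i))) (\<lambda>n. T i ((s \<circ> k1) n))"
        "\<And>j. N \<le> j \<Longrightarrow> \<exists>j'\<ge>j. k2 j = k1 j'"
      for i and s :: "nat \<Rightarrow> complex \<Rightarrow> complex" and k1 k2 :: "nat \<Rightarrow> nat" and N
    proof (rule spherical_convergent_on_subseq[OF that(1), of N])
      show "\<exists>ia\<ge>j. T i ((s \<circ> k2) j) = T i ((s \<circ> k1) ia)" if "N \<le> j" for j
        using \<open>\<And>j. N \<le> j \<Longrightarrow> \<exists>j'\<ge>j. k2 j = k1 j'\<close>[OF that] by auto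
    qed
  qed blast
  define B where "B = (\<lambda>i. ball (c i) (d (c i)))"
  have conv: "spherical_convergent_on (B i) (F \<circ> k)" for i
  proof -
    have "\<forall>\<^sub>F n in sequentially. good i (F (k n))"
      using ev[OF c\<Omega>[of i]] k(1) unfolding good_def by (rule eventually_subseq[rotated])
    then have "\<forall>\<^sub>F n in sequentially. T i ((F \<circ> k) n) = (F \<circ> k) n"
      by (rule eventually_mono) (simp add: T_def)
    then obtain N where N: "\<forall>n\<ge>N. T i ((F \<circ> k) n) = (F \<circ> k) n"
      unfolding eventually_sequentially by blast
    show ?thesis
      using k(2)[of i] unfolding B_def
      by (rule spherical_convergent_on_subseq[where N = N]) (use N in force)
  qed
  define fin where "fin = (\<lambda>i. \<exists>g. g holomorphic_on B i \<and> uniform_limit (B i) (F \<circ> k) g sequentially)"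
  define inf where "inf = (\<lambda>i. \<forall>b. \<forall>\<^sub>F n in sequentially. \<forall>z\<in>B i. b \<le> norm ((F \<circ> k) n z))"
  have cases: "fin i \<or> inf i" for i
    using conv[of i] by (simp add: spherical_convergent_on_def fin_def inf_def)
  have opB: "open (B i)" for i by (simp add: B_def)
  have neB: "B i \<noteq> {}" for i using d(2)[OF c\<Omega>] by (simp add: B_def not_le)
  have cover: "(\<Union>i. B i) = \<Omega>" using c by (simp add: B_def)
  have disj: "B i \<inter> B j = {}" if "fin i" "inf j" for i j
  proof (rule ccontr)
    assume "B i \<inter> B j \<noteq> {}"
    then obtain z where z: "z \<in> B i" "z \<in> B j" by blast
    obtain g where "uniform_limit (B i) (F \<circ> k) g sequentially" using \<open>fin i\<close> by (auto simp: fin_def)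
    then have "(\<lambda>n. norm ((F \<circ> k) n z)) \<longlonglongrightarrow> norm (g z)"
      using z by (intro tendsto_norm tendsto_uniform_limitI)
    then have "\<forall>\<^sub>F n in sequentially. norm ((F \<circ> k) n z) < norm (g z) + 1"
      by (rule order_tendstoD) simp
    moreover have "\<forall>\<^sub>F n in sequentially. norm (g z) + 1 \<le> norm ((F \<circ> k) n z)"
      using \<open>inf j\<close>[unfolded inf_def, rule_format, of "norm (g z) + 1"]
      by (rule eventually_mono) (use z in blast)
    ultimately have "\<forall>\<^sub>F n in sequentially. False"
      by eventually_elim auto
    then show False by simp
  qed
  have compact_cover: "\<exists>I. finite I \<and> K \<subseteq> (\<Union>i\<in>I. B i)" if "compact K" "K \<subseteq> \<Omega>" for K
    using compactE_image[OF that(1), of UNIV B] opB that(2) cover by metis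
  \<comment> \<open>The discs with a finite limit and those with limit infinity have open disjoint
    unions that cover \<open>\<Omega>\<close>.\<close>
  have "(\<forall>i. fin i) \<or> (\<forall>i. inf i)"
  proof (rule ccontr)
    assume *: "\<not> ((\<forall>i. fin i) \<or> (\<forall>i. inf i))"
    have "(\<Union>i\<in>{i. fin i}. B i) \<inter> \<Omega> = {} \<or> (\<Union>i\<in>{i. inf i}. B i) \<inter> \<Omega> = {}"
    proof (rule connectedD[OF \<open>connected \<Omega>\<close>])
      show "(\<Union>i\<in>{i. fin i}. B i) \<inter> (\<Union>i\<in>{i. inf i}. B i) \<inter> \<Omega> = {}"
        using disj by blast
      show "\<Omega> \<subseteq> (\<Union>i\<in>{i. fin i}. B i) \<union> (\<Union>i\<in>{i. inf i}. B i)"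
        using cover cases by blast
    qed (use opB in auto)
    moreover obtain i j where "inf i" "fin j" using * cases by blast
    moreover have "B i \<subseteq> \<Omega>" "B j \<subseteq> \<Omega>" using cover by auto
    ultimately show False using neB[of i] neB[of j] by blast
  qed
  then show thesis
  proof
    assume "\<forall>i. fin i"
    then obtain G where G: "\<And>i. G i holomorphic_on B i" "\<And>i. uniform_limit (B i) (F \<circ> k) (G i) sequentially"
      unfolding fin_def by metis
    \<comment> \<open>The pointwise limit glues the local limits, with which it agrees by uniqueness
      of limits.\<close>
    define g where "g = (\<lambda>z. lim (\<lambda>n. (F \<circ> k) n z))"
    have gG: "g z = G i z" if "z \<in> B i" for i z
      unfolding g_def using tendsto_uniform_limitI[OF G(2) that] by (rule limI)
    have lim: "uniform_limit (B i) (F \<circ> k) g sequentially" for i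
      using G(2)[of i] gG[of _ i] by (simp cong: uniform_limit_cong')
    have "g holomorphic_on B i" for i
      using G(1)[of i] gG[of _ i] by (simp cong: holomorphic_cong)
    then have "g holomorphic_on \<Omega>"
      unfolding cover[symmetric] using opB by (intro holomorphic_on_UN_open) auto
    moreover have "uniform_limit K (F \<circ> k) g sequentially" if K: "compact K" "K \<subseteq> \<Omega>" for K
    proof -
      obtain I where I: "finite I" "K \<subseteq> (\<Union>i\<in>I. B i)" using compact_cover[OF K] by blast
      have "uniform_limit (\<Union>i\<in>I. B i) (F \<circ> k) g sequentially"
        by (rule uniform_limit_on_UNION[OF I(1)]) (rule lim)
      then show ?thesis using I(2) by (rule uniform_limit_on_subset)
    qed
    ultimately show thesis using that[OF k(1)] by blast
  next
    assume inf: "\<forall>i. inf i"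
    have "\<forall>\<^sub>F n in sequentially. \<forall>z\<in>K. b \<le> norm ((F \<circ> k) n z)" if K: "compact K" "K \<subseteq> \<Omega>" for K b
    proof -
      obtain I where I: "finite I" "K \<subseteq> (\<Union>i\<in>I. B i)" using compact_cover[OF K] by blast
      have "\<forall>\<^sub>F n in sequentially. \<forall>i\<in>I. \<forall>z\<in>B i. b \<le> norm ((F \<circ> k) n z)"
        using inf I(1) by (intro eventually_ball_finite) (auto simp: inf_def)
      then show ?thesis
        by (rule eventually_mono) (use I(2) in blast)
    qed
    then show thesis using that[OF k(1)] by blast
  qed
qed

section \<open>Zero-free entire functions with bounded spherical derivative\<close>

text \<open>The Cayley map sends the right half-plane to the unit disc and \<open>q 0\<close> to 0,
  so Schwarz's lemma applies to the composition \<open>\<phi>\<close>. Its derivative part gives the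
  first bound; the second, a form of Harnack's inequality, is |\<phi>(\<xi>)| \<le> |\<xi>|
  rewritten for real parts.\<close>

lemma half_plane_Schwarz_unit:
  assumes hol: "q holomorphic_on ball 0 1" and pos: "\<And>z. norm z < 1 \<Longrightarrow> Re (q z) > 0"
  shows "norm (deriv q 0) \<le> 2 * Re (q 0)"
    and "norm \<xi> < 1 \<Longrightarrow> Re (q 0) * (1 - norm \<xi>) \<le> Re (q \<xi>) * (1 + norm \<xi>)"
proof -
  define a where "a = q 0"
  have a: "Re a > 0" using pos[of 0] by (simp add: a_def)
  define \<phi> where "\<phi> = (\<lambda>z. (q z - a) / (q z + cnj a))"
  have nz: "q z + cnj a \<noteq> 0" if "norm z < 1" for z
    using pos[OF that] a by (auto simp: complex_eq_iff)
  have sq: "(norm (q z + cnj a))\<^sup>2 - (norm (q z - a))\<^sup>2 = 4 * Re a * Re (q z)" for z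
    unfolding cmod_power2 by (simp add: power2_eq_square algebra_simps)
  have hol\<phi>: "\<phi> holomorphic_on ball 0 1"
    unfolding \<phi>_def using nz by (intro holomorphic_intros hol) auto
  have "\<phi> 0 = 0" by (simp add: \<phi>_def a_def)
  have lt1: "norm (\<phi> z) < 1" if "norm z < 1" for z
  proof -
    have "(norm (q z - a))\<^sup>2 < (norm (q z + cnj a))\<^sup>2"
      using sq[of z] a pos[OF that] by (smt (verit) mult_pos_pos)
    then have "norm (q z - a) < norm (q z + cnj a)"
      by (rule power_less_imp_less_base) simp
    then show ?thesis
      using nz[OF that] by (simp add: \<phi>_def norm_divide)
  qed
  have der: "norm (deriv \<phi> 0) \<le> 1" and le: "\<And>\<xi>. norm \<xi> < 1 \<Longrightarrow> norm (\<phi> \<xi>) \<le> norm \<xi>"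
    using Schwarz_Lemma[OF hol\<phi> \<open>\<phi> 0 = 0\<close> lt1] by (auto intro: Schwarz_Lemma(2)[OF hol\<phi> \<open>\<phi> 0 = 0\<close> lt1, of 0])
  have "(q has_field_derivative deriv q 0) (at 0)"
    using hol by (auto intro: holomorphic_derivI[of q "ball 0 1"])
  then have "(\<phi> has_field_derivative deriv q 0 / (a + cnj a)) (at 0)"
    unfolding \<phi>_def using nz[of 0]
    by (auto intro!: derivative_eq_intros simp: a_def power2_eq_square)
  then have "deriv \<phi> 0 = deriv q 0 / (a + cnj a)" by (rule DERIV_imp_deriv)
  moreover have "norm (a + cnj a) = 2 * Re a" using a by (simp add: complex_add_cnj)
  ultimately show "norm (deriv q 0) \<le> 2 * Re (q 0)"
    using der a by (simp add: norm_divide a_def)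
  show "Re (q 0) * (1 - norm \<xi>) \<le> Re (q \<xi>) * (1 + norm \<xi>)" if \<xi>: "norm \<xi> < 1"
  proof -
    define s where "s = norm \<xi>"
    have s: "0 \<le> s" "s < 1" using \<xi> by (auto simp: s_def)
    define X A Y where "X = Re (q \<xi>)" and "A = Re a" and "Y = Im (q \<xi>) - Im a"
    have XA: "X > 0" "A > 0" using pos[OF \<xi>] a by (auto simp: X_def A_def)
    have "norm (q \<xi> - a) \<le> s * norm (q \<xi> + cnj a)"
      using le[OF \<xi>] nz[OF \<xi>] by (simp add: \<phi>_def norm_divide s_def divide_le_eq)
    then have "(norm (q \<xi> - a))\<^sup>2 \<le> (s * norm (q \<xi> + cnj a))\<^sup>2"
      by (rule power_mono) simp
    then have "(X - A)\<^sup>2 + Y\<^sup>2 \<le> s\<^sup>2 * ((X + A)\<^sup>2 + Y\<^sup>2)"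
      by (simp add: power_mult_distrib cmod_power2 X_def A_def Y_def)
    moreover have "s\<^sup>2 * Y\<^sup>2 \<le> Y\<^sup>2"
      using s by (simp add: mult_left_le_one_le power_le_one)
    moreover have "s\<^sup>2 * ((X + A)\<^sup>2 + Y\<^sup>2) = s\<^sup>2 * (X + A)\<^sup>2 + s\<^sup>2 * Y\<^sup>2"
      by (rule distrib_left)
    moreover have "(s * (X + A))\<^sup>2 = s\<^sup>2 * (X + A)\<^sup>2"
      by (rule power_mult_distrib)
    moreover have "(A - X)\<^sup>2 = (X - A)\<^sup>2"
      by (rule power2_commute)
    ultimately have "(A - X)\<^sup>2 \<le> (s * (X + A))\<^sup>2"
      by linarith
    moreover have "0 \<le> s * (X + A)"
      using s XA by simp
    ultimately have "A - X \<le> s * (X + A)"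
      by (rule power2_le_imp_le)
    then have "A * (1 - s) \<le> X * (1 + s)"
      by (simp add: algebra_simps)
    then show ?thesis by (simp only: X_def A_def a_def s_def)
  qed
qed

lemma half_plane_Schwarz:
  assumes hol: "p holomorphic_on ball z R" and "R > 0" and pos: "\<And>y. y \<in> ball z R \<Longrightarrow> Re (p y) > 0"
  shows "norm (deriv p z) * R \<le> 2 * Re (p z)"
    and "norm \<xi> < 1 \<Longrightarrow> Re (p z) * (1 - norm \<xi>) \<le> 2 * Re (p (z + of_real R * \<xi>))"
proof -
  define q where "q = (\<lambda>\<xi>. p (z + of_real R * \<xi>))"
  have in_ball: "z + of_real R * \<xi> \<in> ball z R" if "norm \<xi> < 1" for \<xi>
    using that \<open>R > 0\<close> by (simp add: dist_norm norm_mult)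
  have holq: "q holomorphic_on ball 0 1"
    unfolding q_def
    by (rule holomorphic_on_compose_gen[OF _ hol, of "\<lambda>\<xi>. z + of_real R * \<xi>" "ball 0 1", unfolded o_def])
      (use in_ball in \<open>auto intro!: holomorphic_intros\<close>)
  have posq: "Re (q \<xi>) > 0" if "norm \<xi> < 1" for \<xi>
    using pos in_ball[OF that] by (simp add: q_def)
  have dp: "(p has_field_derivative deriv p z) (at (z + of_real R * 0))"
    using hol \<open>R > 0\<close> by (auto intro: holomorphic_derivI[of p "ball z R"])
  have "(q has_field_derivative deriv p z * of_real R) (at 0)"
    unfolding q_def by (rule DERIV_chain2[of p "deriv p z" "\<lambda>\<xi>. z + of_real R * \<xi>" 0, OF dp]) (auto intro!: derivative_eq_intros)
  then have "deriv q 0 = deriv p z * of_real R" by (rule DERIV_imp_deriv)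
  then show "norm (deriv p z) * R \<le> 2 * Re (p z)"
    using half_plane_Schwarz_unit(1)[OF holq posq] \<open>R > 0\<close> by (simp add: norm_mult q_def)
  show "Re (p z) * (1 - norm \<xi>) \<le> 2 * Re (p (z + of_real R * \<xi>))" if \<xi>: "norm \<xi> < 1"
  proof -
    have "Re (p z) * (1 - norm \<xi>) \<le> Re (q \<xi>) * (1 + norm \<xi>)"
      using half_plane_Schwarz_unit(2)[OF holq posq \<xi>] by (simp add: q_def)
    also have "\<dots> \<le> Re (q \<xi>) * 2"
      using posq[OF \<xi>] \<xi> by (intro mult_left_mono) auto
    finally show ?thesis by (simp add: q_def)
  qed
qed

text \<open>If $w$ is a point of the level set closest to $z$, then Harnack's inequality on the disc
  around $z$ through $w$ bounds the normal derivative at $w$ from below (Hopf's lemma), so that the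
  bound on the level set propagates to $z$.\<close>

lemma deriv_bound_from_level_set_pos:
  assumes hol: "p holomorphic_on UNIV" and K: "\<And>w. Re (p w) = 0 \<Longrightarrow> norm (deriv p w) \<le> K"
    and "K \<ge> 0" "Re (p z) > 0"
  shows "norm (deriv p z) \<le> 4 * K"
proof -
  have cont: "continuous_on S p" for S
    using hol holomorphic_on_imp_continuous_on holomorphic_on_subset by blast
  have pos_ball: "Re (p y) > 0" if "y \<in> ball z R" "\<And>w. w \<in> ball z R \<Longrightarrow> Re (p w) \<noteq> 0" for y R
  proof (rule ccontr)
    assume "\<not> Re (p y) > 0"
    have "R > 0" using that(1) by (metis ball_eq_empty empty_iff not_le)
    have "connected ((\<lambda>w. Re (p w)) ` ball z R)"
      by (intro connected_continuous_image continuous_intros cont) simp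
    moreover have "Re (p y) \<in> (\<lambda>w. Re (p w)) ` ball z R" "Re (p z) \<in> (\<lambda>w. Re (p w)) ` ball z R"
      using that(1) \<open>R > 0\<close> by auto
    ultimately have "0 \<in> (\<lambda>w. Re (p w)) ` ball z R"
      using \<open>\<not> Re (p y) > 0\<close> \<open>Re (p z) > 0\<close> by (intro connectedD_interval[of _ "Re (p y)" "Re (p z)" 0]) auto
    then show False using that(2) by auto
  qed
  show ?thesis
  proof (cases "\<exists>w. Re (p w) = 0")
    case False
    \<comment> \<open>Without a level set \<open>p\<close> maps the whole plane into the right
      half-plane, so the Schwarz bound holds for every radius and the derivative must
      vanish.\<close>
    have *: "norm (deriv p z) * R \<le> 2 * Re (p z)" if "R > 0" for R
    proof (rule half_plane_Schwarz(1)[OF _ that])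
      show "p holomorphic_on ball z R" using hol by (rule holomorphic_on_subset) simp
      show "Re (p y) > 0" if "y \<in> ball z R" for y
        using pos_ball[OF that] False by blast
    qed
    have "norm (deriv p z) = 0"
    proof (rule ccontr)
      assume "norm (deriv p z) \<noteq> 0"
      then show False
        using *[of "(2 * Re (p z) + 1) / norm (deriv p z)"] \<open>Re (p z) > 0\<close> by simp
    qed
    then show ?thesis using \<open>K \<ge> 0\<close> by simp
  next
    case True
    define Z where "Z = {w. Re (p w) = 0}"
    have "closed Z"
      unfolding Z_def by (intro closed_Collect_eq continuous_intros cont)
    moreover have "Z \<noteq> {}" using True by (auto simp: Z_def)
    ultimately obtain w where w: "w \<in> Z" "\<And>y. y \<in> Z \<Longrightarrow> dist z w \<le> dist z y"
      using distance_attains_inf[of Z z] by blast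
    define R where "R = dist z w"
    have w0: "Re (p w) = 0" using w(1) by (simp add: Z_def)
    then have "w \<noteq> z" using \<open>Re (p z) > 0\<close> by auto
    then have "R > 0" by (simp add: R_def)
    have pos: "Re (p y) > 0" if "y \<in> ball z R" for y
    proof (rule pos_ball[OF that])
      fix x assume "x \<in> ball z R"
      then have "\<not> dist z w \<le> dist z x" by (simp add: R_def)
      then have "x \<notin> Z" using w(2) by blast
      then show "Re (p x) \<noteq> 0" by (simp add: Z_def)
    qed
    have holR: "p holomorphic_on ball z R" using hol holomorphic_on_subset by blast
    \<comment> \<open>Harnack bounds \<open>Re p\<close> from below by a multiple of 1 - s at a
      point whose distance to \<open>w\<close> is (1 - s) R. The factor 1 - s cancels and leaves a
      bound on the difference quotient that does not depend on s.\<close>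
    have grow: "norm ((p (z + of_real s * (w - z)) - p w) / ((z + of_real s * (w - z)) - w)) \<ge> Re (p z) / (2 * R)"
      if s: "0 < s" "s < 1" for s
    proof -
      define \<xi> where "\<xi> = of_real s * ((w - z) / of_real R)"
      have n\<xi>: "norm \<xi> = s" using s \<open>R > 0\<close> by (simp add: \<xi>_def norm_mult norm_divide R_def dist_norm norm_minus_commute)
      have eq: "z + of_real R * \<xi> = z + of_real s * (w - z)" using \<open>R > 0\<close> by (simp add: \<xi>_def)
      have "Re (p z) * (1 - s) \<le> 2 * Re (p (z + of_real s * (w - z)))"
        using half_plane_Schwarz(2)[OF holR \<open>R > 0\<close> pos, of \<xi>] s n\<xi> eq by simp
      also have "\<dots> \<le> 2 * norm (p (z + of_real s * (w - z)) - p w)"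
        using complex_Re_le_cmod[of "p (z + of_real s * (w - z)) - p w"] w0 by simp
      finally have 1: "Re (p z) * (1 - s) / 2 \<le> norm (p (z + of_real s * (w - z)) - p w)" by simp
      have "(z + of_real s * (w - z)) - w = of_real (1 - s) * (z - w)" by (simp add: algebra_simps)
      then have 2: "norm ((z + of_real s * (w - z)) - w) = (1 - s) * R"
        using s by (simp only: norm_mult norm_of_real R_def dist_norm)
      have "Re (p z) / (2 * R) = (Re (p z) * (1 - s) / 2) / ((1 - s) * R)"
        using s \<open>R > 0\<close> by (simp add: field_simps)
      also have "\<dots> \<le> norm (p (z + of_real s * (w - z)) - p w) / ((1 - s) * R)"
        using 1 s \<open>R > 0\<close> by (intro divide_right_mono) auto
      finally show ?thesis by (simp only: norm_divide 2)
    qed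
    have "(p has_field_derivative deriv p w) (at w)"
      using hol by (auto intro: holomorphic_derivI)
    then have lim: "((\<lambda>y. (p y - p w) / (y - w)) \<longlongrightarrow> deriv p w) (at w)"
      by (simp add: has_field_derivative_iff)
    have "filterlim (\<lambda>s. z + of_real s * (w - z)) (at w) (at_left 1)"
    proof (subst filterlim_at, safe)
      have "((\<lambda>s. z + of_real s * (w - z)) \<longlongrightarrow> z + of_real 1 * (w - z)) (at_left 1)"
        by (intro tendsto_intros)
      then show "((\<lambda>s. z + of_real s * (w - z)) \<longlongrightarrow> w) (at_left 1)" by simp
      have "\<forall>\<^sub>F s in at_left 1. s \<noteq> (1::real)"
        by (simp add: eventually_at_filter)
      then show "\<forall>\<^sub>F s in at_left 1. z + of_real s * (w - z) \<in> UNIV \<and> z + of_real s * (w - z) \<noteq> w"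
      proof (rule eventually_mono, safe)
        fix s :: real assume "s \<noteq> 1" "z + of_real s * (w - z) = w"
        then have "(of_real s - 1) * (w - z) = 0" by (simp add: algebra_simps)
        then show False using \<open>s \<noteq> 1\<close> \<open>w \<noteq> z\<close> by simp
      qed simp
    qed
    from filterlim_compose[OF lim this]
    have "((\<lambda>s. (p (z + of_real s * (w - z)) - p w) / ((z + of_real s * (w - z)) - w)) \<longlongrightarrow> deriv p w) (at_left (1::real))" .
    then have "((\<lambda>s. norm ((p (z + of_real s * (w - z)) - p w) / ((z + of_real s * (w - z)) - w))) \<longlongrightarrow> norm (deriv p w)) (at_left (1::real))"
      by (rule tendsto_norm)
    then have "Re (p z) / (2 * R) \<le> norm (deriv p w)"
    proof (rule tendsto_lowerbound)
      have "\<forall>\<^sub>F s in at_left 1. s \<in> {0<..<1::real}"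
        by (rule eventually_at_leftI[of 0]) auto
      then show "\<forall>\<^sub>F s in at_left (1::real). Re (p z) / (2 * R) \<le> norm ((p (z + of_real s * (w - z)) - p w) / ((z + of_real s * (w - z)) - w))"
        by (rule eventually_mono) (rule grow, auto)
    qed simp
    also have "\<dots> \<le> K" using K w0 by blast
    \<comment> \<open>The radius cancels between Re p(z) \<le> 2KR and |p'(z)| R \<le> 2 Re p(z);
      the product of the two factors 2 is the 4 of the claim.\<close>
    finally have "Re (p z) \<le> K * (2 * R)" using \<open>R > 0\<close> by (simp add: divide_le_eq)
    moreover have "norm (deriv p z) * R \<le> 2 * Re (p z)"
      by (rule half_plane_Schwarz(1)[OF holR \<open>R > 0\<close> pos])
    ultimately have "norm (deriv p z) * R \<le> (4 * K) * R" by simp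
    then show ?thesis using \<open>R > 0\<close> by simp
  qed
qed

lemma deriv_bound_from_level_set:
  assumes hol: "p holomorphic_on UNIV" and K: "\<And>w. Re (p w) = 0 \<Longrightarrow> norm (deriv p w) \<le> K"
    and "K \<ge> 0"
  shows "norm (deriv p z) \<le> 4 * K"
proof -
  have d: "deriv (\<lambda>z. - p z) w = - deriv p w" for w
    using hol by (intro deriv_minus holomorphic_on_imp_differentiable_at[of p UNIV]) auto
  consider "Re (p z) > 0" | "Re (p z) = 0" | "Re (- p z) > 0" by fastforce
  then show ?thesis
  proof cases
    case 1
    show ?thesis by (rule deriv_bound_from_level_set_pos[OF hol _ \<open>K \<ge> 0\<close> 1]) (rule K)
  next
    case 2 then show ?thesis using K[of z] \<open>K \<ge> 0\<close> by simp
  next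
    case 3
    have "norm (deriv (\<lambda>z. - p z) z) \<le> 4 * K"
    proof (rule deriv_bound_from_level_set_pos)
      show "(\<lambda>z. - p z) holomorphic_on UNIV" using hol by (rule holomorphic_on_minus)
      show "norm (deriv (\<lambda>z. - p z) w) \<le> K" if "Re (- p w) = 0" for w
        using K[of w] that by (simp add: d)
    qed (use 3 \<open>K \<ge> 0\<close> in auto)
    then show ?thesis by (simp add: d)
  qed
qed

text \<open>For \<open>v = exp p\<close> the spherical bound reads |p'| \<le> C (|v| + 1/|v|), which
  gives a uniform bound on the curve |v| = 1, that is Re p = 0.
  \<open>deriv_bound_from_level_set\<close> carries it to the whole plane, and Liouville's theorem
  makes p' constant.\<close>

lemma zero_free_spherical_bounded_entire:
  assumes bd: "spherical_bounded_on UNIV C v" and nz: "\<And>z. v z \<noteq> 0"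
  obtains a d where "\<And>z. v z = exp (a * z + d)"
proof -
  have hol: "v holomorphic_on UNIV" and le: "\<And>z. norm (deriv v z) \<le> C * (1 + (norm (v z))\<^sup>2)"
    using bd by (auto simp: spherical_bounded_on_def)
  obtain p where p: "p holomorphic_on UNIV" "\<And>z. v z = exp (p z)"
    using contractible_imp_holomorphic_log[OF hol contractible_UNIV] nz by auto
  have dp: "(p has_field_derivative deriv p z) (at z)" for z
    using p(1) by (auto intro: holomorphic_derivI)
  have dv: "deriv v z = v z * deriv p z" for z
  proof -
    have "((\<lambda>z. exp (p z)) has_field_derivative exp (p z) * deriv p z) (at z)"
      by (auto intro!: derivative_eq_intros dp)
    then show ?thesis
      using p(2) by (metis (no_types, lifting) DERIV_imp_deriv ext)
  qed
  have K: "norm (deriv p w) \<le> 2 * max C 0" if "Re (p w) = 0" for w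
  proof -
    have "norm (v w) = 1" using that by (simp add: p(2))
    then have "norm (deriv p w) \<le> C * 2" using le[of w] by (simp add: dv norm_mult)
    then show ?thesis by simp
  qed
  have "bounded (range (deriv p))"
    unfolding bounded_iff using deriv_bound_from_level_set[OF p(1) K] by auto
  then have "deriv p constant_on UNIV"
    using Liouville_theorem p(1) holomorphic_deriv by blast
  then obtain a where a: "\<And>z. deriv p z = a" by (auto simp: constant_on_def)
  have "((\<lambda>z. p z - a * z) has_field_derivative 0) (at z)" for z
    using dp[of z] by (auto intro!: derivative_eq_intros simp: a)
  then have "\<exists>d. \<forall>z\<in>UNIV. p z - a * z = d"
    by (intro has_field_derivative_zero_constant convex_UNIV)
  then obtain d where d: "p z - a * z = d" for z
    by blast
  have "p z = a * z + d" for z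
    unfolding d[of z, symmetric] by simp
  then show thesis using that[of a d] p(2) by simp
qed

section \<open>Square roots and their rescalings\<close>

definition root_defect :: "(complex \<Rightarrow> complex) \<Rightarrow> complex \<Rightarrow> complex" where
  "root_defect u = (\<lambda>z. (deriv u z)\<^sup>2 + u z * deriv (deriv u) z - 1)"

text \<open>The bound \<open>M\<close> and the domain \<open>U\<close> are parameters because they
  are what a zoom changes; \<open>\<beta>\<close> stays fixed.\<close>

definition admissible_root :: "complex \<Rightarrow> real \<Rightarrow> complex set \<Rightarrow> (complex \<Rightarrow> complex) \<Rightarrow> bool" where
  "admissible_root \<beta> M U u \<longleftrightarrow> u holomorphic_on U \<and>
     (\<forall>z\<in>U. (u z = 0 \<longrightarrow> (deriv u z)\<^sup>2 = 1) \<and>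
        (root_defect u z = 0 \<longrightarrow> (u z = 0 \<or> (deriv u z)\<^sup>2 = \<beta>) \<and>
           0 < norm (deriv (root_defect u) z) \<and> norm (deriv (root_defect u) z) \<le> M))"

lemma root_defect_holomorphic:
  assumes "u holomorphic_on U" "open U"
  shows "root_defect u holomorphic_on U"
  unfolding root_defect_def
  by (intro holomorphic_intros assms holomorphic_deriv)

lemma deriv_eq_on_open:
  assumes "open U" "z \<in> U" "\<And>x. x \<in> U \<Longrightarrow> f x = g x"
  shows "deriv f z = deriv g z"
proof (rule deriv_cong_ev)
  show "\<forall>\<^sub>F x in nhds z. f x = g x"
    using eventually_nhds_in_open[OF assms(1,2)] by (rule eventually_mono) (rule assms(3))
qed simp

lemma norm_eq_1_if_square_eq_1: "w\<^sup>2 = 1 \<Longrightarrow> norm w = 1" for w :: complex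
  using power2_eq_1_iff[of w] by auto

lemma deriv_affine_compose:
  assumes "f holomorphic_on U" "open U" "a + c * z \<in> U"
  shows "deriv (\<lambda>z. f (a + c * z)) z = c * deriv f (a + c * z)"
proof -
  have "((\<lambda>z. f (a + c * z)) has_field_derivative deriv f (a + c * z) * c) (at z)"
    by (rule DERIV_chain2[of f _ "\<lambda>z. a + c * z" z, OF holomorphic_derivI[OF assms]])
      (auto intro!: derivative_eq_intros)
  then show ?thesis by (simp add: DERIV_imp_deriv mult.commute)
qed

lemma rescaled_derivs:
  fixes \<rho> :: real
  assumes u: "u holomorphic_on U" and "open U" "\<rho> > 0"
    and sub: "\<And>\<zeta>. \<zeta> \<in> V \<Longrightarrow> a + of_real \<rho> * \<zeta> \<in> U" and "open V" and \<zeta>: "\<zeta> \<in> V"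
  defines "v \<equiv> \<lambda>\<zeta>. u (a + of_real \<rho> * \<zeta>) / of_real \<rho>"
  shows "deriv v \<zeta> = deriv u (a + of_real \<rho> * \<zeta>)"
    and "root_defect v \<zeta> = root_defect u (a + of_real \<rho> * \<zeta>)"
    and "deriv (root_defect v) \<zeta> = of_real \<rho> * deriv (root_defect u) (a + of_real \<rho> * \<zeta>)"
    and "v holomorphic_on V"
proof -
  have holv: "(\<lambda>\<zeta>. u (a + of_real \<rho> * \<zeta>)) holomorphic_on V"
    by (rule holomorphic_on_compose_gen[OF _ u, of "\<lambda>\<zeta>. a + of_real \<rho> * \<zeta>", unfolded o_def])
      (use sub in \<open>auto intro!: holomorphic_intros\<close>)
  then show "v holomorphic_on V"
    unfolding v_def by (intro holomorphic_intros) (use \<open>\<rho> > 0\<close> in auto)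
  have 1: "deriv v \<zeta> = deriv u (a + of_real \<rho> * \<zeta>)" if \<zeta>: "\<zeta> \<in> V" for \<zeta>
  proof -
    have "deriv v \<zeta> = deriv (\<lambda>\<zeta>. u (a + of_real \<rho> * \<zeta>)) \<zeta> / of_real \<rho>"
      unfolding v_def using holv \<zeta> \<open>open V\<close>
      by (intro deriv_cdivide_right holomorphic_on_imp_differentiable_at)
    then show ?thesis
      using deriv_affine_compose[OF u \<open>open U\<close> sub[OF \<zeta>]] \<open>\<rho> > 0\<close> by simp
  qed
  have 2: "deriv (deriv v) \<zeta> = of_real \<rho> * deriv (deriv u) (a + of_real \<rho> * \<zeta>)" if \<zeta>: "\<zeta> \<in> V" for \<zeta>
    using deriv_eq_on_open[OF \<open>open V\<close> \<zeta> 1]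
      deriv_affine_compose[OF holomorphic_deriv[OF u \<open>open U\<close>] \<open>open U\<close> sub[OF \<zeta>]] by simp
  have 3: "root_defect v \<zeta> = root_defect u (a + of_real \<rho> * \<zeta>)" if \<zeta>: "\<zeta> \<in> V" for \<zeta>
    using \<open>\<rho> > 0\<close> by (simp add: root_defect_def 1[OF \<zeta>] 2[OF \<zeta>]) (simp add: v_def)
  show "deriv v \<zeta> = deriv u (a + of_real \<rho> * \<zeta>)" "root_defect v \<zeta> = root_defect u (a + of_real \<rho> * \<zeta>)"
    using 1 3 \<zeta> by auto
  show "deriv (root_defect v) \<zeta> = of_real \<rho> * deriv (root_defect u) (a + of_real \<rho> * \<zeta>)"
    using deriv_eq_on_open[OF \<open>open V\<close> \<zeta> 3]
      deriv_affine_compose[OF root_defect_holomorphic[OF u \<open>open U\<close>] \<open>open U\<close> sub[OF \<zeta>]] by simp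
qed

lemma admissible_root_rescale:
  fixes \<rho> :: real
  assumes adm: "admissible_root \<beta> M U u" and "open U" "\<rho> > 0" "M * \<rho> \<le> M'"
    and sub: "\<And>\<zeta>. \<zeta> \<in> V \<Longrightarrow> a + of_real \<rho> * \<zeta> \<in> U" and "open V"
  shows "admissible_root \<beta> M' V (\<lambda>\<zeta>. u (a + of_real \<rho> * \<zeta>) / of_real \<rho>)"
proof -
  have u: "u holomorphic_on U" using adm by (simp add: admissible_root_def)
  note rd = rescaled_derivs[OF u \<open>open U\<close> \<open>\<rho> > 0\<close> sub \<open>open V\<close>]
  show ?thesis
    unfolding admissible_root_def
  proof (intro conjI ballI impI; (elim conjE)?)
    have ad: "(u (a + of_real \<rho> * \<zeta>) = 0 \<longrightarrow> (deriv u (a + of_real \<rho> * \<zeta>))\<^sup>2 = 1) \<and>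
        (root_defect u (a + of_real \<rho> * \<zeta>) = 0 \<longrightarrow> (u (a + of_real \<rho> * \<zeta>) = 0 \<or> (deriv u (a + of_real \<rho> * \<zeta>))\<^sup>2 = \<beta>) \<and>
           0 < norm (deriv (root_defect u) (a + of_real \<rho> * \<zeta>)) \<and> norm (deriv (root_defect u) (a + of_real \<rho> * \<zeta>)) \<le> M)"
      if "\<zeta> \<in> V" for \<zeta>
      using adm sub[OF that] unfolding admissible_root_def by blast
    show "(\<lambda>\<zeta>. u (a + of_real \<rho> * \<zeta>) / of_real \<rho>) holomorphic_on V"
    proof (cases "V = {}")
      case False
      then obtain \<zeta> where "\<zeta> \<in> V" by blast
      then show ?thesis by (rule rd(4)[rotated])
    qed (simp add: holomorphic_on_def)
    fix \<zeta> assume \<zeta>: "\<zeta> \<in> V"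
    {
      assume "u (a + of_real \<rho> * \<zeta>) / of_real \<rho> = 0"
      then show "(deriv (\<lambda>\<zeta>. u (a + of_real \<rho> * \<zeta>) / of_real \<rho>) \<zeta>)\<^sup>2 = 1"
        using ad[OF \<zeta>] \<open>\<rho> > 0\<close> by (simp add: rd(1)[OF _ \<zeta>])
    next
      assume "root_defect (\<lambda>\<zeta>. u (a + of_real \<rho> * \<zeta>) / of_real \<rho>) \<zeta> = 0"
      then have 0: "root_defect u (a + of_real \<rho> * \<zeta>) = 0" by (simp add: rd(2)[OF _ \<zeta>])
      show "u (a + of_real \<rho> * \<zeta>) / of_real \<rho> = 0 \<or> (deriv (\<lambda>\<zeta>. u (a + of_real \<rho> * \<zeta>) / of_real \<rho>) \<zeta>)\<^sup>2 = \<beta>"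
        using ad[OF \<zeta>] 0 by (auto simp: rd(1)[OF _ \<zeta>])
      show "0 < norm (deriv (root_defect (\<lambda>\<zeta>. u (a + of_real \<rho> * \<zeta>) / of_real \<rho>)) \<zeta>)"
        using ad[OF \<zeta>] 0 \<open>\<rho> > 0\<close> by (simp add: rd(3)[OF _ \<zeta>])
      have "norm (deriv (root_defect (\<lambda>\<zeta>. u (a + of_real \<rho> * \<zeta>) / of_real \<rho>)) \<zeta>)
          = \<rho> * norm (deriv (root_defect u) (a + of_real \<rho> * \<zeta>))"
        using \<open>\<rho> > 0\<close> by (simp add: rd(3)[OF _ \<zeta>] norm_mult)
      also have "\<dots> \<le> \<rho> * M"
        using ad[OF \<zeta>] 0 \<open>\<rho> > 0\<close> by (intro mult_left_mono) auto
      finally show "norm (deriv (root_defect (\<lambda>\<zeta>. u (a + of_real \<rho> * \<zeta>) / of_real \<rho>)) \<zeta>) \<le> M'"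
        using \<open>M * \<rho> \<le> M'\<close> by (simp add: mult.commute)
    }
  qed
qed

text \<open>The reciprocal of \<open>zoom_rate u z\<close> is the scale $\rho$ for which the rescaled function
  $v(\zeta) = u(z + \rho\zeta)/\rho$ satisfies $|v'(0)| = 3(1 + |v(0)|^2)$.\<close>

definition zoom_rate :: "(complex \<Rightarrow> complex) \<Rightarrow> complex \<Rightarrow> real" where
  "zoom_rate u z = sqrt (max 0 (norm (deriv u z) - 3) / 3) / norm (u z)"

lemma zoom_rate_nonneg: "zoom_rate u z \<ge> 0"
  by (simp add: zoom_rate_def)

text \<open>The quotient is delicate only at a zero of \<open>u\<close>. There |u'| = 1, so |u'| < 3
  in a neighbourhood and the truncated numerator is 0 on it; at the zero itself division by 0 also
  yields 0.\<close>

lemma continuous_on_zoom_rate: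
  assumes u: "u holomorphic_on U" and "open U" and z: "\<And>z. z \<in> U \<Longrightarrow> u z = 0 \<Longrightarrow> (deriv u z)\<^sup>2 = 1"
  shows "continuous_on U (zoom_rate u)"
proof (rule continuous_at_imp_continuous_on, rule ballI)
  fix x assume x: "x \<in> U"
  have cu: "isCont u x" and cd: "isCont (deriv u) x"
    using x u \<open>open U\<close> holomorphic_deriv[OF u \<open>open U\<close>]
    by (auto intro: field_differentiable_imp_continuous_at holomorphic_on_imp_differentiable_at)
  show "isCont (zoom_rate u) x"
  proof (cases "u x = 0")
    case False
    then show ?thesis
      unfolding zoom_rate_def[abs_def] by (intro continuous_intros cu cd) auto
  next
    case True
    then have "norm (deriv u x) = 1"
      by (intro norm_eq_1_if_square_eq_1 z[OF x])
    moreover have "isCont (\<lambda>z. norm (deriv u z)) x"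
      by (intro continuous_intros cd)
    then have "((\<lambda>z. norm (deriv u z)) \<longlongrightarrow> norm (deriv u x)) (nhds x)"
      unfolding isCont_def tendsto_at_iff_tendsto_nhds[of "\<lambda>z. norm (deriv u z)"] .
    ultimately have "\<forall>\<^sub>F z in nhds x. norm (deriv u z) < 3"
      by (intro order_tendstoD(2)[of _ "norm (deriv u x)"]) auto
    then have "\<forall>\<^sub>F z in nhds x. zoom_rate u z = 0"
      by (rule eventually_mono) (simp add: zoom_rate_def)
    then show ?thesis
      by (subst isCont_cong[of _ "\<lambda>_. 0"]) auto
  qed
qed

text \<open>Zalcman's choice of centre: maximize the rate times the distance to the boundary of a
  slightly smaller disc. Around the maximum point \<open>a\<close> the rate is at most twice its
  value \<open>s\<close> at \<open>a\<close>, on a disc that has radius at least \<open>N\<close>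
  after dilation by \<open>s\<close>.\<close>

lemma admissible_root_zoom:
  fixes N :: real
  assumes adm: "admissible_root \<beta> M (ball x r) u" and "r > 0" "M \<ge> 0" "N > 0"
    and y: "y \<in> ball x (r/2)" and big: "zoom_rate u y \<ge> 4 * N" "zoom_rate u y \<ge> 8 * N / r"
  obtains v where "admissible_root \<beta> (M / N) (ball 0 N) v"
    "\<And>z. z \<in> ball 0 N \<Longrightarrow> norm (deriv v z) \<le> 3 + 12 * (norm (v z))\<^sup>2"
    "norm (deriv v 0) = 3 + 3 * (norm (v 0))\<^sup>2"
proof -
  \<comment> \<open>A point of \<open>ball x (r/2)\<close> keeps at least the distance r/4 to the
    circle of radius 3r/4, and the closed disc of that radius is a compact part of
    \<open>ball x r\<close>.\<close>
  define r' where "r' = 3 * r / 4"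
  have u: "u holomorphic_on ball x r" and u0: "\<And>z. z \<in> ball x r \<Longrightarrow> u z = 0 \<Longrightarrow> (deriv u z)\<^sup>2 = 1"
    using adm by (auto simp: admissible_root_def)
  have sub: "cball x r' \<subseteq> ball x r" using \<open>r > 0\<close> by (auto simp: r'_def)
  have "continuous_on (cball x r') (\<lambda>z. zoom_rate u z * (r' - dist x z))"
    by (intro continuous_intros continuous_on_subset[OF continuous_on_zoom_rate[OF u open_ball u0] sub])
  moreover have "cball x r' \<noteq> {}" using \<open>r > 0\<close> by (simp add: r'_def)
  ultimately obtain a where a: "a \<in> cball x r'"
    and max: "\<And>z. z \<in> cball x r' \<Longrightarrow> zoom_rate u z * (r' - dist x z) \<le> zoom_rate u a * (r' - dist x a)"
    using continuous_attains_sup[of "cball x r'" "\<lambda>z. zoom_rate u z * (r' - dist x z)"] by auto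
  define s d where "s = zoom_rate u a" and "d = r' - dist x a"
  have "zoom_rate u y * (r / 4) \<le> zoom_rate u y * (r' - dist x y)"
    using y zoom_rate_nonneg[of u y] by (intro mult_left_mono) (auto simp: r'_def)
  also have "\<dots> \<le> s * d"
    unfolding s_def d_def using y \<open>r > 0\<close> by (intro max) (auto simp: r'_def)
  finally have sd: "zoom_rate u y * (r / 4) \<le> s * d" .
  have zy: "zoom_rate u y > 0" using big(1) \<open>N > 0\<close> by linarith
  have "d \<ge> 0" using a by (simp add: d_def)
  have "s * d > 0" using sd zy \<open>r > 0\<close> by (smt (verit) mult_pos_pos divide_pos_pos)
  then have "s > 0" "d > 0"
    using \<open>d \<ge> 0\<close> zoom_rate_nonneg[of u a] by (auto simp: s_def zero_less_mult_iff)
  define \<rho> where "\<rho> = 1 / s"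
  have "\<rho> > 0" using \<open>s > 0\<close> by (simp add: \<rho>_def)
  have "d \<le> r" using \<open>r > 0\<close> zero_le_dist[of x a] unfolding d_def r'_def by linarith
  \<comment> \<open>The two lower bounds on the rate at \<open>y\<close> have different purposes.
    \<open>4 * N\<close> gives \<open>s \<ge> N\<close>, which turns the bound M into M/N;
    \<open>8 * N / r\<close> gives \<open>s * d / 2 \<ge> N\<close>, which keeps the zoomed disc
    where the weight \<open>r' - dist x z\<close> is at least d/2.\<close>
  have sN: "s \<ge> N"
  proof -
    have "4 * N * (r/4) \<le> zoom_rate u y * (r/4)"
      using big(1) \<open>r > 0\<close> by (intro mult_right_mono) auto
    also have "\<dots> \<le> s * r"
      using sd mult_left_mono[OF \<open>d \<le> r\<close>, of s] \<open>s > 0\<close> by linarith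
    finally show ?thesis using \<open>r > 0\<close> by simp
  qed
  have dN: "s * d / 2 \<ge> N"
  proof -
    have "8 * N / r * (r/4) \<le> zoom_rate u y * (r/4)"
      using big(2) \<open>r > 0\<close> by (intro mult_right_mono) auto
    then show ?thesis using sd \<open>r > 0\<close> by simp
  qed
  have near: "dist x (a + of_real \<rho> * \<zeta>) \<le> r' - d/2" if "\<zeta> \<in> ball 0 N" for \<zeta>
  proof -
    have "norm (of_real \<rho> * \<zeta>) \<le> \<rho> * (s * d / 2)"
      using that dN \<open>\<rho> > 0\<close> by (simp add: norm_mult)
    also have "\<dots> = d/2" using \<open>s > 0\<close> by (simp add: \<rho>_def)
    finally have "dist a (a + of_real \<rho> * \<zeta>) \<le> d/2" by (simp add: dist_norm)
    then have "dist x (a + of_real \<rho> * \<zeta>) \<le> dist x a + d/2"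
      using dist_triangle[of x "a + of_real \<rho> * \<zeta>" a] by linarith
    also have "\<dots> = r' - d/2" by (simp add: d_def field_simps)
    finally show ?thesis .
  qed
  have inU: "a + of_real \<rho> * \<zeta> \<in> ball x r" if "\<zeta> \<in> ball 0 N" for \<zeta>
    using near[OF that] \<open>d > 0\<close> \<open>r > 0\<close> by (simp add: r'_def)
  have rate: "zoom_rate u (a + of_real \<rho> * \<zeta>) \<le> 2 * s" if "\<zeta> \<in> ball 0 N" for \<zeta>
  proof -
    let ?z = "a + of_real \<rho> * \<zeta>"
    have "zoom_rate u ?z * (d/2) \<le> zoom_rate u ?z * (r' - dist x ?z)"
      using near[OF that] zoom_rate_nonneg[of u ?z] by (intro mult_left_mono) auto
    also have "\<dots> \<le> s * d"
      unfolding s_def d_def using near[OF that] \<open>d > 0\<close> by (intro max) auto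
    finally show ?thesis using \<open>d > 0\<close> by simp
  qed
  define v where "v = (\<lambda>\<zeta>. u (a + of_real \<rho> * \<zeta>) / of_real \<rho>)"
  have dv: "deriv v \<zeta> = deriv u (a + of_real \<rho> * \<zeta>)" if "\<zeta> \<in> ball 0 N" for \<zeta>
    unfolding v_def by (rule rescaled_derivs(1)[OF u open_ball \<open>\<rho> > 0\<close> inU open_ball that])
  have nv: "norm (v \<zeta>) = s * norm (u (a + of_real \<rho> * \<zeta>))" for \<zeta>
    using \<open>s > 0\<close> by (simp add: v_def \<rho>_def norm_mult norm_divide)
  have N0: "0 \<in> ball (0::complex) N" using \<open>N > 0\<close> by simp
  show thesis
  proof (rule that[of v])
    have "M * \<rho> \<le> M / N"
      using sN \<open>N > 0\<close> \<open>M \<ge> 0\<close> \<open>s > 0\<close> by (auto simp: \<rho>_def intro: divide_left_mono)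
    then show "admissible_root \<beta> (M / N) (ball 0 N) v"
      unfolding v_def by (intro admissible_root_rescale[OF adm open_ball \<open>\<rho> > 0\<close> _ inU open_ball])
    show "norm (deriv v \<zeta>) \<le> 3 + 12 * (norm (v \<zeta>))\<^sup>2" if \<zeta>: "\<zeta> \<in> ball 0 N" for \<zeta>
    proof -
      let ?z = "a + of_real \<rho> * \<zeta>"
      show ?thesis
      proof (cases "u ?z = 0")
        case True
        then have "norm (deriv u ?z) = 1"
          using u0[OF inU[OF \<zeta>]] norm_eq_1_if_square_eq_1 by blast
        then show ?thesis by (simp add: dv[OF \<zeta>] nv True)
      next
        case False
        \<comment> \<open>A rate of at most 2s becomes, after squaring, the constant 12 = 3 * 4 of
          the growth bound.\<close>
        then have "sqrt (max 0 (norm (deriv u ?z) - 3) / 3) \<le> 2 * norm (v \<zeta>)"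
          using rate[OF \<zeta>] by (simp add: zoom_rate_def nv divide_le_eq)
        then have "max 0 (norm (deriv u ?z) - 3) / 3 \<le> (2 * norm (v \<zeta>))\<^sup>2"
          by (rule sqrt_le_D)
        then show ?thesis by (simp add: dv[OF \<zeta>] power_mult_distrib)
      qed
    qed
    have "sqrt (max 0 (norm (deriv u a) - 3) / 3) / norm (u a) = s"
      by (simp add: s_def zoom_rate_def)
    \<comment> \<open>At a zero of \<open>u\<close> the division by 0 would make the rate 0.\<close>
    then have "u a \<noteq> 0" using \<open>s > 0\<close> by auto
    then have sq: "sqrt (max 0 (norm (deriv u a) - 3) / 3) = norm (v 0)"
      using \<open>sqrt (max 0 (norm (deriv u a) - 3) / 3) / norm (u a) = s\<close> by (simp add: nv field_simps)
    then have "norm (deriv u a) > 3"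
      using \<open>u a \<noteq> 0\<close> \<open>s > 0\<close> by (cases "norm (deriv u a) > 3") (auto simp: nv)
    moreover have "max 0 (norm (deriv u a) - 3) / 3 = (norm (v 0))\<^sup>2"
      unfolding sq[symmetric] by simp
    ultimately show "norm (deriv v 0) = 3 + 3 * (norm (v 0))\<^sup>2"
      by (simp add: dv[OF N0])
  qed
qed

section \<open>Limits of rescaled square roots\<close>

lemma entire_limit_root_defect:
  assumes "entire_limit V v"
  shows "entire_limit (\<lambda>n. root_defect (V n)) (root_defect v)"
  unfolding root_defect_def power2_eq_square
  by (intro entire_limit_diff entire_limit_const entire_limit_add entire_limit_mult entire_limit_deriv assms)

text \<open>Compares orders of vanishing: once the common powers of z - x are cancelled, a positive
  power is left on the right-hand side only.\<close>

lemma vanishes_if_dominated: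
  fixes l Y :: "complex \<Rightarrow> complex"
  assumes "isCont l x" "isCont Y x" "m > 0"
    and le: "\<forall>\<^sub>F z in at x. norm (l z) \<le> K * norm (z - x) ^ m * norm (Y z)"
  shows "l x = 0"
proof -
  have "((\<lambda>z. norm (l z)) \<longlongrightarrow> norm (l x)) (at x)"
    using assms(1) by (intro tendsto_norm) (simp add: isCont_def)
  moreover have "((\<lambda>z. K * norm (z - x) ^ m * norm (Y z)) \<longlongrightarrow> K * norm (x - x) ^ m * norm (Y x)) (at x)"
    using assms(2) by (intro tendsto_intros) (simp add: isCont_def)
  ultimately have "norm (l x) \<le> K * norm (x - x) ^ m * norm (Y x)"
    using le by (intro tendsto_le[of "at x"]) auto
  then show ?thesis using \<open>m > 0\<close> by (simp add: power_0_left)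
qed

text \<open>What an unbounded zoom rate would produce; the locale is shown to be inconsistent.
  \<open>\<epsilon>\<close> bounds the derivatives of the approximating defects at their zeros, and
  \<open>centre\<close> keeps \<open>v\<close> away from functions with v'^2 = 1.\<close>

locale root_limit =
  fixes V :: "nat \<Rightarrow> complex \<Rightarrow> complex" and v :: "complex \<Rightarrow> complex"
    and \<beta> :: complex and \<epsilon> :: "nat \<Rightarrow> real" and C :: real
  assumes lim: "entire_limit V v"
    and \<epsilon>: "\<epsilon> \<longlonglongrightarrow> 0"
    and adm: "\<And>R. \<forall>\<^sub>F n in sequentially. admissible_root \<beta> (\<epsilon> n) (ball 0 R) (V n)"
    and bounded: "spherical_bounded_on UNIV C v"
    and centre: "norm (deriv v 0) \<ge> 3"
begin

lemma v_hol: "v holomorphic_on UNIV"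
  using lim by (simp add: entire_limit_def)

lemma deriv_v_hol: "deriv v holomorphic_on UNIV" "deriv (deriv v) holomorphic_on UNIV"
  using v_hol by (auto intro: holomorphic_deriv)

lemma has_derivs:
  "(v has_field_derivative deriv v z) (at z)"
  "(deriv v has_field_derivative deriv (deriv v) z) (at z)"
  "(deriv (deriv v) has_field_derivative deriv (deriv (deriv v)) z) (at z)"
  using v_hol deriv_v_hol by (auto intro: holomorphic_derivI)

lemma deriv_root_defect:
  "deriv (root_defect v) z = 3 * deriv v z * deriv (deriv v) z + v z * deriv (deriv (deriv v)) z"
proof -
  have "(root_defect v has_field_derivative
      3 * deriv v z * deriv (deriv v) z + v z * deriv (deriv (deriv v)) z) (at z)"
    unfolding root_defect_def
    by (auto intro!: derivative_eq_intros has_derivs simp: algebra_simps)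
  then show ?thesis by (rule DERIV_imp_deriv)
qed

lemma v_nonconst: "\<exists>y. v y \<noteq> 0"
proof (rule ccontr)
  assume "\<nexists>y. v y \<noteq> 0"
  then have "v = (\<lambda>_. 0)" by auto
  then show False using centre by simp
qed

lemma lim_deriv_sq:
  "entire_limit (\<lambda>n z. (deriv (V n) z)\<^sup>2 - 1) (\<lambda>z. (deriv v z)\<^sup>2 - 1)"
  unfolding power2_eq_square
  by (intro entire_limit_diff entire_limit_const entire_limit_mult entire_limit_deriv lim)

lemma deriv_sq_at_zero:
  assumes "v x = 0"
  shows "(deriv v x)\<^sup>2 = 1"
proof -
  obtain y where "v y \<noteq> 0" using v_nonconst by blast
  have "(deriv v x)\<^sup>2 - 1 = 0"
  proof (rule Hurwitz_transfer[OF lim lim_deriv_sq assms \<open>v y \<noteq> 0\<close>, of "\<lambda>_. 0"])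
    show "\<forall>\<^sub>F n in sequentially. \<forall>z\<in>ball 0 R. V n z = 0 \<longrightarrow> norm ((deriv (V n) z)\<^sup>2 - 1) \<le> 0" for R
      using adm[of R] by (rule eventually_mono) (auto simp: admissible_root_def)
  qed simp
  then show ?thesis by simp
qed

text \<open>At a zero of \<open>V n\<close> the derivative squares to 1, so the defect vanishes too,
  and there the derivative of the defect is at most \<open>\<epsilon> n\<close>.\<close>

lemma deriv_root_defect_at_zero:
  assumes "v x = 0"
  shows "deriv (root_defect v) x = 0"
proof -
  obtain y where "v y \<noteq> 0" using v_nonconst by blast
  show ?thesis
  proof (rule Hurwitz_transfer[OF lim entire_limit_deriv[OF entire_limit_root_defect[OF lim]] assms \<open>v y \<noteq> 0\<close> \<epsilon>])
    show "\<forall>\<^sub>F n in sequentially. \<forall>z\<in>ball 0 R. V n z = 0 \<longrightarrow> norm (deriv (root_defect (V n)) z) \<le> \<epsilon> n" for R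
      using adm[of R]
    proof (rule eventually_mono, intro ballI impI)
      fix n z assume *: "admissible_root \<beta> (\<epsilon> n) (ball 0 R) (V n)" "z \<in> ball 0 R" "V n z = 0"
      then have "(deriv (V n) z)\<^sup>2 = 1" by (auto simp: admissible_root_def)
      then have "root_defect (V n) z = 0" using * by (simp add: root_defect_def)
      then show "norm (deriv (root_defect (V n)) z) \<le> \<epsilon> n"
        using * unfolding admissible_root_def by blast
    qed
  qed
qed

lemma root_defect_zero_multiple:
  assumes "root_defect v x = 0"
  shows "deriv (root_defect v) x = 0"
proof (cases "\<exists>y. root_defect v y \<noteq> 0")
  case True
  then obtain y where y: "root_defect v y \<noteq> 0" by blast
  show ?thesis
  proof (rule Hurwitz_transfer[OF entire_limit_root_defect[OF lim] entire_limit_deriv[OF entire_limit_root_defect[OF lim]] assms y \<epsilon>])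
    show "\<forall>\<^sub>F n in sequentially. \<forall>z\<in>ball 0 R. root_defect (V n) z = 0 \<longrightarrow> norm (deriv (root_defect (V n)) z) \<le> \<epsilon> n" for R
      using adm[of R] by (rule eventually_mono) (auto simp: admissible_root_def)
  qed
next
  case False
  then have "root_defect v = (\<lambda>_. 0)" by auto
  then show ?thesis by simp
qed

text \<open>An identically vanishing defect means (v v')' = 1. With a zero at \<open>x\<close> this
  integrates to v v' = z - x and then to v^2 = (z - x)^2, so that v'(0)^2 = 1, against
  \<open>centre\<close>.\<close>

lemma root_defect_nonzero:
  assumes x: "v x = 0"
  shows "\<exists>y. root_defect v y \<noteq> 0"
proof (rule ccontr)
  assume "\<not> ?thesis"
  then have w0: "(deriv v z)\<^sup>2 + v z * deriv (deriv v) z - 1 = 0" for z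
    by (simp add: root_defect_def)
  have "((\<lambda>z. v z * deriv v z - z) has_field_derivative 0) (at z)" for z
    using w0[of z]
    by (auto intro!: derivative_eq_intros has_derivs simp: algebra_simps power2_eq_square)
  then have "\<exists>c. \<forall>z\<in>UNIV. v z * deriv v z - z = c"
    by (intro has_field_derivative_zero_constant convex_UNIV)
  then obtain c where c: "v z * deriv v z - z = c" for z by blast
  have "c = - x" using c[of x] x by simp
  then have vd: "v z * deriv v z = z - x" for z
    using c[of z] by (simp add: diff_eq_eq)
  have "((\<lambda>z. (v z)\<^sup>2 - (z - x)\<^sup>2) has_field_derivative 0) (at z)" for z
    using vd[of z]
    by (auto intro!: derivative_eq_intros has_derivs simp: mult.commute)
  then have "\<exists>c. \<forall>z\<in>UNIV. (v z)\<^sup>2 - (z - x)\<^sup>2 = c"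
    by (intro has_field_derivative_zero_constant convex_UNIV)
  then obtain c' where c': "(v z)\<^sup>2 - (z - x)\<^sup>2 = c'" for z by blast
  have sq: "(v 0)\<^sup>2 = (0 - x)\<^sup>2" using c'[of 0] c'[of x] x by simp
  have "v 0 \<noteq> 0"
  proof
    assume "v 0 = 0"
    then have "norm (deriv v 0) = 1" by (intro norm_eq_1_if_square_eq_1 deriv_sq_at_zero)
    then show False using centre by simp
  qed
  have "(v 0)\<^sup>2 * (deriv v 0)\<^sup>2 = (v 0)\<^sup>2"
  proof -
    have "(v 0)\<^sup>2 * (deriv v 0)\<^sup>2 = (v 0 * deriv v 0)\<^sup>2"
      by (rule power_mult_distrib[symmetric])
    also have "\<dots> = (0 - x)\<^sup>2" by (simp only: vd)
    finally show ?thesis by (simp only: sq)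
  qed
  then have "(deriv v 0)\<^sup>2 = 1" using \<open>v 0 \<noteq> 0\<close> by simp
  then have "norm (deriv v 0) = 1" by (rule norm_eq_1_if_square_eq_1)
  then show False using centre by simp
qed

lemma eventually_admissible_on:
  "\<forall>\<^sub>F n in sequentially. admissible_root \<beta> (\<epsilon> n) (ball x r) (V n)"
proof -
  have "ball x r \<subseteq> ball 0 (norm x + \<bar>r\<bar>)"
  proof
    fix z assume "z \<in> ball x r"
    then show "z \<in> ball 0 (norm x + \<bar>r\<bar>)"
      using norm_triangle_sub[of z x] by (simp add: dist_norm norm_minus_commute)
  qed
  with adm[of "norm x + \<bar>r\<bar>"] show ?thesis
    by (elim eventually_mono) (auto simp: admissible_root_def intro: holomorphic_on_subset)
qed

text \<open>At a zero \<open>x\<close> of \<open>v\<close> the defect \<open>w\<close> vanishes doubly, while the zeros of the approximating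
  defects \<open>w\<^sub>n\<close> are simple. If \<open>\<beta> \<noteq> 1\<close>, all zeros of \<open>w\<^sub>n\<close> near \<open>x\<close> are zeros of \<open>v\<^sub>n\<close>; if
  \<open>\<beta> = 1\<close>, then \<open>(v\<^sub>n'\<^sup>2 - 1) v\<^sub>n\<close> vanishes doubly at all of them. So the quotients below are
  holomorphic, and by the maximum principle their limits are bounded.\<close>

lemma quotient_bound_generic:
  assumes x: "v x = 0" and "\<beta> \<noteq> 1"
  obtains r K where "r > 0" "K > 0" "\<And>z. z \<in> cball x r \<Longrightarrow> norm (v z) \<le> K * norm (root_defect v z)"
proof -
  \<comment> \<open>Near \<open>x\<close> the square of v' is within \<open>d\<close> of 1, and the
    square of the derivative of \<open>V n\<close> is within \<open>d\<close> of that of v'. As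
    \<open>d\<close> is half the distance from \<beta> to 1, the alternative with \<beta> is
    impossible, and zeros of the defect of \<open>V n\<close> are zeros of
    \<open>V n\<close>.\<close>
  define d where "d = norm (\<beta> - 1) / 2"
  have "d > 0" using \<open>\<beta> \<noteq> 1\<close> by (simp add: d_def)
  have "isCont (\<lambda>z. (deriv v z)\<^sup>2) x"
    using has_derivs(2) by (intro continuous_intros) (rule DERIV_isCont)
  then obtain e where e: "e > 0" "\<And>z. dist z x < e \<Longrightarrow> dist ((deriv v z)\<^sup>2) ((deriv v x)\<^sup>2) < d"
    using \<open>d > 0\<close> by (auto simp: continuous_at_eps_delta)
  obtain y where y: "root_defect v y \<noteq> 0" using root_defect_nonzero[OF x] by blast
  have rd0: "root_defect v x = 0" using x deriv_sq_at_zero[OF x] by (simp add: root_defect_def)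
  obtain r where r: "0 < r" "r < e" "\<And>z. z \<in> cball x r - {x} \<Longrightarrow> root_defect v z \<noteq> 0"
    using isolated_zero_entire[OF root_defect_holomorphic[OF v_hol open_UNIV] rd0 y \<open>e > 0\<close>] by blast
  note W = entire_limit_root_defect[OF lim]
  have "\<forall>\<^sub>F n in sequentially. admissible_root \<beta> (\<epsilon> n) (ball x e) (V n) \<and>
      (\<forall>z\<in>cball x e. dist ((deriv (V n) z)\<^sup>2 - 1) ((deriv v z)\<^sup>2 - 1) < d)"
    by (intro eventually_conj eventually_admissible_on
        uniform_limitD[OF entire_limit_cball(1)[OF lim_deriv_sq] \<open>d > 0\<close>])
  then have "\<forall>\<^sub>F n in sequentially. \<exists>H. H holomorphic_on cball x r \<and> (\<forall>z\<in>cball x r. V n z = root_defect (V n) z * H z)"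
  proof (rule eventually_mono, elim conjE)
    fix n assume ad: "admissible_root \<beta> (\<epsilon> n) (ball x e) (V n)"
      and close: "\<forall>z\<in>cball x e. dist ((deriv (V n) z)\<^sup>2 - 1) ((deriv v z)\<^sup>2 - 1) < d"
    have Vhol: "V n holomorphic_on ball x e" using ad by (simp add: admissible_root_def)
    obtain H where H: "H holomorphic_on ball x e" "\<And>z. z \<in> ball x e \<Longrightarrow> V n z = root_defect (V n) z * H z"
    proof (rule holomorphic_quotient_simple_zeros[OF Vhol root_defect_holomorphic[OF Vhol open_ball] open_ball])
      fix z assume z: "z \<in> ball x e" and rd: "root_defect (V n) z = 0"
      have "(deriv (V n) z)\<^sup>2 \<noteq> \<beta>"
      proof
        assume eq: "(deriv (V n) z)\<^sup>2 = \<beta>"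
        have "z \<in> cball x e" using z by simp
        then have "dist ((deriv (V n) z)\<^sup>2 - 1) ((deriv v z)\<^sup>2 - 1) < d" using close by blast
        then have 1: "dist \<beta> ((deriv v z)\<^sup>2) < d" by (simp add: dist_norm eq)
        have 2: "dist ((deriv v z)\<^sup>2) 1 < d"
          using e(2)[of z] z deriv_sq_at_zero[OF x] by (simp add: dist_commute)
        have "dist \<beta> 1 < 2 * d"
          using dist_triangle[of \<beta> 1 "(deriv v z)\<^sup>2"] 1 2 by linarith
        then show False by (simp add: d_def dist_norm)
      qed
      then show "V n z = 0 \<and> deriv (root_defect (V n)) z \<noteq> 0"
        using ad z rd unfolding admissible_root_def by fastforce
    qed blast
    show "\<exists>H. H holomorphic_on cball x r \<and> (\<forall>z\<in>cball x r. V n z = root_defect (V n) z * H z)"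
      using r(2) by (intro exI[of _ H] conjI ballI H(2) holomorphic_on_subset[OF H(1)]) auto
  qed
  then have fr: "\<exists>\<^sub>F n in sequentially. \<exists>H. H holomorphic_on cball x r \<and> (\<forall>z\<in>cball x r. V n z = root_defect (V n) z * H z)"
    by (simp add: eventually_frequently)
  obtain K where "K > 0" "\<And>z. z \<in> cball x r \<Longrightarrow> norm (v z) \<le> K * norm (root_defect v z)"
  proof (rule quotient_limit_bound[OF entire_limit_cball(1)[OF lim] entire_limit_cball(1)[OF W] \<open>0 < r\<close>
        entire_limit_cball(3)[OF lim] entire_limit_cball(3)[OF W] _ fr])
    show "root_defect v z \<noteq> 0" if "z \<in> sphere x r" for z
      using r that by auto
  qed blast
  then show thesis using that \<open>0 < r\<close> by blast
qed

lemma quotient_bound_critical: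
  assumes x: "v x = 0" and "\<beta> = 1"
  obtains r K where "r > 0" "K > 0"
    "\<And>z. z \<in> cball x r \<Longrightarrow> norm (((deriv v z)\<^sup>2 - 1) * v z) \<le> K * norm (root_defect v z * root_defect v z)"
proof -
  obtain y where y: "root_defect v y \<noteq> 0" using root_defect_nonzero[OF x] by blast
  have rd0: "root_defect v x = 0" using x deriv_sq_at_zero[OF x] by (simp add: root_defect_def)
  obtain r where r: "0 < r" "r < 1" "\<And>z. z \<in> cball x r - {x} \<Longrightarrow> root_defect v z \<noteq> 0"
    using isolated_zero_entire[OF root_defect_holomorphic[OF v_hol open_UNIV] rd0 y zero_less_one] by blast
  note W = entire_limit_mult[OF entire_limit_root_defect[OF lim] entire_limit_root_defect[OF lim]]
  note P = entire_limit_mult[OF lim_deriv_sq lim]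
  have "\<forall>\<^sub>F n in sequentially. \<exists>H. H holomorphic_on cball x r \<and>
      (\<forall>z\<in>cball x r. ((deriv (V n) z)\<^sup>2 - 1) * V n z = root_defect (V n) z * root_defect (V n) z * H z)"
    using eventually_admissible_on[of x 1]
  proof (rule eventually_mono)
    fix n assume ad: "admissible_root \<beta> (\<epsilon> n) (ball x 1) (V n)"
    have Vhol: "V n holomorphic_on ball x 1" using ad by (simp add: admissible_root_def)
    have Dhol: "deriv (V n) holomorphic_on ball x 1" using Vhol by (simp add: holomorphic_deriv)
    note Whol = root_defect_holomorphic[OF Vhol open_ball]
    have Phol: "(\<lambda>z. ((deriv (V n) z)\<^sup>2 - 1) * V n z) holomorphic_on ball x 1"
      by (intro holomorphic_intros Vhol Dhol)
    \<comment> \<open>Where the defect vanishes and the derivative squares to 1, the product of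
      \<open>V n\<close> and its second derivative is 0. Either factor being 0 kills the derivative
      of the numerator.\<close>
    have zero: "V n z = 0 \<and> (deriv (V n) z)\<^sup>2 = 1 \<or> deriv (deriv (V n)) z = 0 \<and> (deriv (V n) z)\<^sup>2 = 1"
      and simple: "deriv (root_defect (V n)) z \<noteq> 0"
      if z: "z \<in> ball x 1" and rd: "root_defect (V n) z = 0" for z
    proof -
      have *: "(V n z = 0 \<longrightarrow> (deriv (V n) z)\<^sup>2 = 1) \<and> (V n z = 0 \<or> (deriv (V n) z)\<^sup>2 = 1)"
        using ad z rd \<open>\<beta> = 1\<close> unfolding admissible_root_def by blast
      then show "V n z = 0 \<and> (deriv (V n) z)\<^sup>2 = 1 \<or> deriv (deriv (V n)) z = 0 \<and> (deriv (V n) z)\<^sup>2 = 1"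
        using rd by (auto simp: root_defect_def)
      show "deriv (root_defect (V n)) z \<noteq> 0"
        using ad z rd unfolding admissible_root_def by fastforce
    qed
    obtain H where H: "H holomorphic_on ball x 1"
        "\<And>z. z \<in> ball x 1 \<Longrightarrow> ((deriv (V n) z)\<^sup>2 - 1) * V n z = root_defect (V n) z * H z"
      and H0: "\<And>z. z \<in> ball x 1 \<Longrightarrow> root_defect (V n) z = 0 \<Longrightarrow>
          H z = deriv (\<lambda>z. ((deriv (V n) z)\<^sup>2 - 1) * V n z) z / deriv (root_defect (V n)) z"
    proof (rule holomorphic_quotient_simple_zeros[OF Phol Whol open_ball])
      fix z assume z: "z \<in> ball x 1" "root_defect (V n) z = 0"
      show "((deriv (V n) z)\<^sup>2 - 1) * V n z = 0 \<and> deriv (root_defect (V n)) z \<noteq> 0"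
        using zero[OF z] simple[OF z] by auto
    qed blast
    \<comment> \<open>By its l'Hopital value the first quotient still vanishes at the simple zeros
      of the defect, which permits a second division.\<close>
    have H00: "H z = 0" if z: "z \<in> ball x 1" and rd: "root_defect (V n) z = 0" for z
    proof -
      have d: "(V n has_field_derivative deriv (V n) z) (at z)"
          "(deriv (V n) has_field_derivative deriv (deriv (V n)) z) (at z)"
        using Vhol Dhol z by (auto intro: holomorphic_derivI)
      have "((\<lambda>z. ((deriv (V n) z)\<^sup>2 - 1) * V n z) has_field_derivative
          2 * deriv (V n) z * deriv (deriv (V n)) z * V n z + ((deriv (V n) z)\<^sup>2 - 1) * deriv (V n) z) (at z)"
        by (auto intro!: derivative_eq_intros d)
      then have "deriv (\<lambda>z. ((deriv (V n) z)\<^sup>2 - 1) * V n z) z = 0"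
        using zero[OF z rd] by (auto simp: DERIV_imp_deriv)
      then show ?thesis using H0[OF z rd] by simp
    qed
    obtain H' where H': "H' holomorphic_on ball x 1" "\<And>z. z \<in> ball x 1 \<Longrightarrow> H z = root_defect (V n) z * H' z"
    proof (rule holomorphic_quotient_simple_zeros[OF H(1) Whol open_ball])
      fix z assume z: "z \<in> ball x 1" "root_defect (V n) z = 0"
      show "H z = 0 \<and> deriv (root_defect (V n)) z \<noteq> 0"
        using H00[OF z] simple[OF z] by blast
    qed blast
    show "\<exists>H. H holomorphic_on cball x r \<and>
      (\<forall>z\<in>cball x r. ((deriv (V n) z)\<^sup>2 - 1) * V n z = root_defect (V n) z * root_defect (V n) z * H z)"
    proof (intro exI[of _ H'] conjI ballI)
      show "H' holomorphic_on cball x r"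
        using r(2) by (intro holomorphic_on_subset[OF H'(1)]) auto
      fix z assume "z \<in> cball x r"
      then have "z \<in> ball x 1" using r(2) by auto
      then show "((deriv (V n) z)\<^sup>2 - 1) * V n z = root_defect (V n) z * root_defect (V n) z * H' z"
        using H(2) H'(2) by (simp add: mult.assoc)
    qed
  qed
  then have fr: "\<exists>\<^sub>F n in sequentially. \<exists>H. H holomorphic_on cball x r \<and>
      (\<forall>z\<in>cball x r. ((deriv (V n) z)\<^sup>2 - 1) * V n z = root_defect (V n) z * root_defect (V n) z * H z)"
    by (simp add: eventually_frequently)
  obtain K where "K > 0" "\<And>z. z \<in> cball x r \<Longrightarrow>
      norm (((deriv v z)\<^sup>2 - 1) * v z) \<le> K * norm (root_defect v z * root_defect v z)"
  proof (rule quotient_limit_bound[OF entire_limit_cball(1)[OF P] entire_limit_cball(1)[OF W] \<open>0 < r\<close>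
        entire_limit_cball(3)[OF P] entire_limit_cball(3)[OF W] _ fr])
    show "root_defect v z * root_defect v z \<noteq> 0" if "z \<in> sphere x r" for z
      using r that by auto
  qed blast
  then show thesis using that \<open>0 < r\<close> by blast
qed

text \<open>Let \<open>q\<close> be the order of k = v'^2 - 1 at \<open>x\<close>. From 2 v' w = 2
  v' k + v k' the defect w vanishes to order at least \<open>q\<close>, and v''(x) = 0 yields q
  \<ge> 2. Now |v| \<le> K |w| would require 1 \<ge> q, and |k v| \<le> K |w|^2 would require q + 1
  \<ge> 2q; both are false.\<close>

lemma v_zero_free: "v x \<noteq> 0"
proof
  assume x: "v x = 0"
  define k where "k = (\<lambda>z. (deriv v z)\<^sup>2 - 1)"
  have khol: "k holomorphic_on UNIV"
    unfolding k_def by (intro holomorphic_intros deriv_v_hol)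
  have "k x = 0" using deriv_sq_at_zero[OF x] by (simp add: k_def)
  have "k 0 \<noteq> 0"
  proof
    assume "k 0 = 0"
    then have "norm (deriv v 0) = 1" by (intro norm_eq_1_if_square_eq_1) (simp add: k_def)
    then show False using centre by simp
  qed
  then have nc: "\<not> k constant_on UNIV" using \<open>k x = 0\<close> unfolding constant_on_def by force
  obtain c r0 q where q: "0 < (q::nat)" and "0 < r0" and chol: "c holomorphic_on ball x r0"
    and kc: "\<And>z. z \<in> ball x r0 \<Longrightarrow> k z = (z - x) ^ q * c z"
    and cnz: "\<And>z. z \<in> ball x r0 \<Longrightarrow> c z \<noteq> 0"
    by (rule holomorphic_factor_zero_nonconstant[OF khol open_UNIV connected_UNIV UNIV_I \<open>k x = 0\<close> nc]) blast
  define a where "a = (\<lambda>z. if z = x then deriv v x else (v z - v x) / (z - x))"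
  have ahol: "a holomorphic_on UNIV"
    unfolding a_def by (rule pole_lemma_open[OF v_hol open_UNIV])
  have va: "v z = (z - x) * a z" for z using x by (simp add: a_def)
  have d1: "deriv v x \<noteq> 0" using deriv_sq_at_zero[OF x] by auto
  have d2: "deriv (deriv v) x = 0"
    using deriv_root_defect_at_zero[OF x] x d1 by (simp add: deriv_root_defect)
  have cder: "(c has_field_derivative deriv c z) (at z)" if "z \<in> ball x r0" for z
    using chol that by (auto intro: holomorphic_derivI)
  have k': "2 * deriv v z * deriv (deriv v) z = of_nat q * (z - x) ^ (q - 1) * c z + (z - x) ^ q * deriv c z"
    if z: "z \<in> ball x r0" for z
  proof -
    have "(k has_field_derivative 2 * deriv v z * deriv (deriv v) z) (at z)"
      unfolding k_def by (auto intro!: derivative_eq_intros has_derivs)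
    moreover have "((\<lambda>z. (z - x) ^ q * c z) has_field_derivative
        of_nat q * (z - x) ^ (q - 1) * c z + (z - x) ^ q * deriv c z) (at z)"
      by (auto intro!: derivative_eq_intros cder z)
    then have "(k has_field_derivative of_nat q * (z - x) ^ (q - 1) * c z + (z - x) ^ q * deriv c z) (at z)"
      by (rule has_field_derivative_transform_within_open[OF _ open_ball z]) (simp add: kc)
    ultimately show ?thesis by (rule DERIV_unique)
  qed
  \<comment> \<open>For q = 1 the formula \<open>k'\<close> at \<open>x\<close> would equate a
    multiple of v''(x) = 0 with c(x), which is nonzero.\<close>
  have "q \<noteq> 1"
    using k'[of x] d2 cnz[of x] \<open>0 < r0\<close> by auto
  then have m: "q - 1 > 0" using q by simp
  \<comment> \<open>The cofactor of \<open>(z - x) ^ q\<close> in 2 v' w; multiplying w by 2 v'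
    trades v'' for the derivative of k, whose factorization is known.\<close>
  define X where "X = (\<lambda>z. 2 * deriv v z * c z + a z * of_nat q * c z + (z - x) * a z * deriv c z)"
  have wX: "2 * deriv v z * root_defect v z = (z - x) ^ q * X z" if z: "z \<in> ball x r0" for z
  proof -
    have pq: "(z - x) * (z - x) ^ (q - 1) = (z - x) ^ q"
      using q by (metis power_minus_mult mult.commute)
    have "2 * deriv v z * root_defect v z = 2 * deriv v z * k z + v z * (2 * deriv v z * deriv (deriv v) z)"
      by (simp add: root_defect_def k_def algebra_simps)
    also have "\<dots> = 2 * deriv v z * ((z - x) ^ q * c z)
        + ((z - x) * (z - x) ^ (q - 1)) * (a z * of_nat q * c z) + (z - x) ^ q * ((z - x) * a z * deriv c z)"
      unfolding k'[OF z] kc[OF z] va[of z] by (simp add: algebra_simps)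
    finally show ?thesis unfolding pq X_def by (simp add: algebra_simps)
  qed
  have contc: "isCont c x" using cder[of x] \<open>0 < r0\<close> by (auto intro: DERIV_isCont)
  have contc': "isCont (deriv c) x"
    using holomorphic_deriv[OF chol open_ball] \<open>0 < r0\<close>
    by (intro field_differentiable_imp_continuous_at holomorphic_on_imp_differentiable_at[OF _ open_ball]) auto
  have conta: "isCont a x"
    by (intro field_differentiable_imp_continuous_at holomorphic_on_imp_differentiable_at[OF ahol]) auto
  have contd: "isCont (deriv v) x" using has_derivs(2) by (rule DERIV_isCont)
  have contX: "isCont X x"
    unfolding X_def by (intro continuous_intros contc contc' conta contd)
  have ax: "a x = deriv v x" by (simp add: a_def)
  have near: "\<forall>\<^sub>F z in at x. z \<in> ball x r0 \<and> z \<in> cball x r \<and> z \<noteq> x" if "r > 0" for r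
    unfolding eventually_at using \<open>0 < r0\<close> that
    by (intro exI[of _ "min r0 r"]) (auto simp: dist_commute)
  show False
  proof (cases "\<beta> = 1")
    case False
    obtain r K where "r > 0" and K: "\<And>z. z \<in> cball x r \<Longrightarrow> norm (v z) \<le> K * norm (root_defect v z)"
      using quotient_bound_generic[OF x False] by blast
    have "a x * (2 * deriv v x) = 0"
    proof (rule vanishes_if_dominated[OF _ contX m])
      show "isCont (\<lambda>z. a z * (2 * deriv v z)) x" by (intro continuous_intros conta contd)
      show "\<forall>\<^sub>F z in at x. norm (a z * (2 * deriv v z)) \<le> K * norm (z - x) ^ (q - 1) * norm (X z)"
        using near[OF \<open>r > 0\<close>]
      proof (rule eventually_mono, elim conjE)
        fix z assume z: "z \<in> ball x r0" "z \<in> cball x r" "z \<noteq> x"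
        have "norm (z - x) * norm (a z * (2 * deriv v z))
            = norm (v z) * norm (2 * deriv v z)"
          unfolding va[of z] by (simp add: norm_mult)
        also have "\<dots> \<le> K * norm (root_defect v z) * norm (2 * deriv v z)"
          by (intro mult_right_mono K z) auto
        also have "\<dots> = K * norm (2 * deriv v z * root_defect v z)"
          by (simp add: norm_mult)
        also have "\<dots> = norm (z - x) * (K * norm (z - x) ^ (q - 1) * norm (X z))"
          unfolding wX[OF z(1)] using q by (cases q) (simp_all add: norm_mult norm_power)
        finally show "norm (a z * (2 * deriv v z)) \<le> K * norm (z - x) ^ (q - 1) * norm (X z)"
          using z(3) by simp
      qed
    qed
    then show False using d1 ax by simp
  next
    case True
    obtain r K where "r > 0" and K: "\<And>z. z \<in> cball x r \<Longrightarrow>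
        norm (((deriv v z)\<^sup>2 - 1) * v z) \<le> K * norm (root_defect v z * root_defect v z)"
      using quotient_bound_critical[OF x True] by blast
    have "c x * a x * (2 * deriv v x)\<^sup>2 = 0"
    proof (rule vanishes_if_dominated[where l = "\<lambda>z. c z * a z * (2 * deriv v z)\<^sup>2"
          and x = x and Y = "\<lambda>z. X z * X z", OF _ _ m])
      show "isCont (\<lambda>z. c z * a z * (2 * deriv v z)\<^sup>2) x" by (intro continuous_intros contc conta contd)
      show "isCont (\<lambda>z. X z * X z) x" by (intro continuous_intros contX)
      show "\<forall>\<^sub>F z in at x. norm (c z * a z * (2 * deriv v z)\<^sup>2) \<le> K * norm (z - x) ^ (q - 1) * norm (X z * X z)"
        using near[OF \<open>r > 0\<close>]
      proof (rule eventually_mono, elim conjE)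
        fix z assume z: "z \<in> ball x r0" "z \<in> cball x r" "z \<noteq> x"
        have kz: "(deriv v z)\<^sup>2 - 1 = (z - x) ^ q * c z" using kc[OF z(1)] by (simp add: k_def)
        \<comment> \<open>The square of 2 v' turns both factors w on the right into
          \<open>(z - x) ^ q * X z\<close>. Of the resulting power 2q, q + 1 cancels and q - 1
          remains.\<close>
        have "norm (z - x) ^ (q + 1) * norm (c z * a z * (2 * deriv v z)\<^sup>2)
            = norm (((deriv v z)\<^sup>2 - 1) * v z) * (norm (2 * deriv v z))\<^sup>2"
          unfolding kz va[of z] by (simp add: norm_mult norm_power)
        also have "\<dots>
            \<le> K * norm (root_defect v z * root_defect v z) * (norm (2 * deriv v z))\<^sup>2"
          by (intro mult_right_mono K z) auto
        also have "\<dots> = K * (norm (2 * deriv v z * root_defect v z))\<^sup>2"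
          by (simp add: norm_mult power2_eq_square)
        also have "\<dots> = norm (z - x) ^ (q + 1) * (K * norm (z - x) ^ (q - 1) * norm (X z * X z))"
          unfolding wX[OF z(1)] using q
          by (cases q) (simp_all add: norm_mult norm_power power2_eq_square)
        finally show "norm (c z * a z * (2 * deriv v z)\<^sup>2) \<le> K * norm (z - x) ^ (q - 1) * norm (X z * X z)"
          using z(3) by simp
      qed
    qed
    then show False using d1 ax cnz[of x] \<open>0 < r0\<close> by simp
  qed
qed

lemma contradiction: False
proof -
  obtain a d where v: "\<And>z. v z = exp (a * z + d)"
    using zero_free_spherical_bounded_entire[OF bounded v_zero_free] by blast
  have "v = (\<lambda>z. exp (a * z + d))" using v by blast
  have d1: "deriv v z = a * v z" for z
    unfolding v by (rule DERIV_imp_deriv) (auto intro!: derivative_eq_intros simp: \<open>v = _\<close>)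
  have d2: "deriv (deriv v) z = a * (a * v z)" for z
  proof -
    have "((\<lambda>z. a * v z) has_field_derivative a * deriv v z) (at z)"
      by (auto intro!: derivative_eq_intros has_derivs)
    then have "deriv (\<lambda>z. a * v z) z = a * (a * v z)" by (simp only: DERIV_imp_deriv d1)
    moreover have "deriv v = (\<lambda>z. a * v z)" using d1 by blast
    ultimately show ?thesis by simp
  qed
  have "a \<noteq> 0" using centre d1[of 0] by auto
  have rd: "root_defect v = (\<lambda>z. 2 * a\<^sup>2 * (v z)\<^sup>2 - 1)"
    by (rule ext) (simp add: root_defect_def d2, simp add: d1 power2_eq_square)
  \<comment> \<open>A solution of exp(2(az + d)) = 1/(2a^2), hence a zero of the defect; the
    derivative of the defect there is 2a.\<close>
  define z where "z = (Ln (1 / (2 * a\<^sup>2)) / 2 - d) / a"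
  have "(v z)\<^sup>2 = exp (2 * (a * z + d))" by (simp only: v exp_double)
  also have "2 * (a * z + d) = Ln (1 / (2 * a\<^sup>2))"
    using \<open>a \<noteq> 0\<close> by (simp add: z_def)
  also have "exp \<dots> = 1 / (2 * a\<^sup>2)"
    using \<open>a \<noteq> 0\<close> by (intro exp_Ln) auto
  finally have vz: "(v z)\<^sup>2 = 1 / (2 * a\<^sup>2)" .
  then have "root_defect v z = 0" using \<open>a \<noteq> 0\<close> by (simp add: rd)
  then have "deriv (root_defect v) z = 0" by (rule root_defect_zero_multiple)
  moreover have "deriv (root_defect v) z = 4 * a * a\<^sup>2 * (v z)\<^sup>2"
    unfolding rd
    by (rule DERIV_imp_deriv)
      (auto intro!: derivative_eq_intros has_derivs simp: d1 power2_eq_square)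
  ultimately show False using vz \<open>a \<noteq> 0\<close> by simp
qed

end

section \<open>Reduction to square roots\<close>

text \<open>On a closed disc inside \<open>D\<close> a function that is not identically zero has
  finitely many zeros, and the square of the polynomial \<open>R\<close> with these as simple roots
  has the same orders as \<open>f\<close> in the open disc. So f = h R^2 with \<open>h\<close>
  zero-free, and \<open>h\<close> has a holomorphic square root on the disc.\<close>

lemma holomorphic_sqrt_of_double_zeros:
  assumes f: "f holomorphic_on D" "open D" "connected D" and "cball x r \<subseteq> D" "r > 0"
    and nz: "w \<in> D" "f w \<noteq> 0"
    and double: "\<And>z. z \<in> D \<Longrightarrow> f z = 0 \<Longrightarrow> zorder f z = 2"
  obtains u where "u holomorphic_on ball x r" "\<And>z. z \<in> ball x r \<Longrightarrow> f z = (u z)\<^sup>2"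
proof -
  define Z where "Z = {z \<in> ball x r. f z = 0}"
  have "finite {z \<in> cball x r. f z = 0}"
  proof (cases "f constant_on D")
    case True
    then obtain c where c: "\<And>z. z \<in> D \<Longrightarrow> f z = c" unfolding constant_on_def by blast
    have "f z \<noteq> 0" if "z \<in> cball x r" for z
      using c[of z] c[OF nz(1)] nz(2) subsetD[OF \<open>cball x r \<subseteq> D\<close> that] by simp
    then have "{z \<in> cball x r. f z = 0} = {}" by blast
    then show ?thesis by (simp only: finite.emptyI)
  next
    case False
    then show ?thesis
      by (intro holomorphic_compact_finite_zeros[OF f compact_cball \<open>cball x r \<subseteq> D\<close>])
  qed
  then have "finite Z" by (rule rev_finite_subset) (auto simp: Z_def)
  define R where "R = (\<lambda>z. \<Prod>a\<in>Z. z - a)"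
  have Rhol: "R holomorphic_on S" for S
    unfolding R_def by (intro holomorphic_on_prod holomorphic_on_diff holomorphic_on_ident holomorphic_on_const)
  have R0: "R z = 0 \<longleftrightarrow> z \<in> Z" for z
    using \<open>finite Z\<close> by (auto simp: R_def)
  have sub: "ball x r \<subseteq> D" using \<open>cball x r \<subseteq> D\<close> by auto
  have fhol: "f holomorphic_on ball x r" using f(1) sub by (rule holomorphic_on_subset)
  have R2hol: "(\<lambda>z. (R z)\<^sup>2) holomorphic_on ball x r"
    by (rule holomorphic_on_power[OF Rhol])
  have ord: "zorder (\<lambda>z. (R z)\<^sup>2) z = zorder f z" if z: "z \<in> ball x r" for z
  proof (cases "f z = 0")
    case True
    then have "z \<in> Z" using z by (simp add: Z_def)
    have "zorder (\<lambda>z. (R z)\<^sup>2) z = 2"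
    proof (rule zorder_eqI[of UNIV z "\<lambda>y. (\<Prod>a\<in>Z - {z}. y - a)\<^sup>2"])
      show "(\<lambda>y. (\<Prod>a\<in>Z - {z}. y - a)\<^sup>2) holomorphic_on UNIV"
        by (intro holomorphic_on_power holomorphic_on_prod holomorphic_on_diff holomorphic_on_ident holomorphic_on_const)
      show "(\<Prod>a\<in>Z - {z}. z - a)\<^sup>2 \<noteq> 0"
        using \<open>finite Z\<close> by (simp add: prod_zero_iff)
      show "(R y)\<^sup>2 = (\<Prod>a\<in>Z - {z}. y - a)\<^sup>2 * (y - z) powi 2" for y
      proof -
        have "R y = (y - z) * (\<Prod>a\<in>Z - {z}. y - a)"
          unfolding R_def by (rule prod.remove[OF \<open>finite Z\<close> \<open>z \<in> Z\<close>])
        then show ?thesis by (simp only: power_mult_distrib power_int_numeral mult.commute)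
      qed
    qed (simp_all only: open_UNIV UNIV_I)
    then show ?thesis unfolding double[OF subsetD[OF sub z] True] .
  next
    case False
    have an: "g analytic_on {z}" if "g holomorphic_on ball x r" for g
      unfolding analytic_at using that z open_ball by blast
    have "(R z)\<^sup>2 \<noteq> 0" using False R0[of z] by (simp add: Z_def)
    then have "zorder (\<lambda>z. (R z)\<^sup>2) z = 0"
      by (rule zorder_eq_0I[OF an[OF R2hol]])
    also have "0 = zorder f z"
      using zorder_eq_0I[OF an[OF fhol] False] by (rule sym)
    finally show ?thesis .
  qed
  obtain h where h: "h holomorphic_on ball x r" "\<And>z. z \<in> ball x r \<Longrightarrow> h z \<noteq> 0"
    "\<And>z. z \<in> ball x r \<Longrightarrow> f z = h z * (R z)\<^sup>2"
  proof (rule holomorphic_zorder_factorization[OF fhol open_ball connected_ball R2hol _ ord])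
    show "(R z)\<^sup>2 = 0 \<longleftrightarrow> f z = 0" if "z \<in> ball x r" for z
      using R0[of z] that by (auto simp: Z_def)
  qed blast+
  obtain s where s: "s holomorphic_on ball x r" "\<And>z. z \<in> ball x r \<Longrightarrow> h z = (s z)\<^sup>2"
    by (rule contractible_imp_holomorphic_sqrt[OF h(1) convex_imp_contractible[OF convex_ball] h(2)]) blast+
  show thesis
  proof (rule that[of "\<lambda>z. s z * R z"])
    show "(\<lambda>z. s z * R z) holomorphic_on ball x r" by (intro holomorphic_intros s Rhol)
    show "f z = (s z * R z)\<^sup>2" if "z \<in> ball x r" for z
      using h(3)[OF that] s(2)[OF that] by (simp add: power_mult_distrib)
  qed
qed

text \<open>The nonzero second derivative caps the order, while the lower bound on the order forces
  f' to vanish. Exactness is what makes the zeros of \<open>f\<close> those of a square with simple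
  roots.\<close>

lemma zorder_eq_2:
  assumes f: "f holomorphic_on D" "open D" "z \<in> D" and "f z = 0" "zorder f z \<ge> 2" "(deriv ^^ 2) f z \<noteq> 0"
  shows "zorder f z = 2"
proof (rule zorder_zero_eqI[OF f])
  have "deriv f z = 0"
  proof (rule ccontr)
    assume "deriv f z \<noteq> 0"
    have "zorder f z = 1"
      by (rule zorder_zero_eqI[OF f]) (use \<open>f z = 0\<close> \<open>deriv f z \<noteq> 0\<close> in auto)
    then show False using \<open>zorder f z \<ge> 2\<close> by simp
  qed
  show "(deriv ^^ i) f z = 0" if "i < nat 2" for i
  proof -
    have "i = 0 \<or> i = 1" using that by auto
    then show ?thesis using \<open>f z = 0\<close> \<open>deriv f z = 0\<close> by auto
  qed
qed (use assms in \<open>auto simp: eval_nat_numeral\<close>)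

lemma derivs_of_scaled_square:
  assumes f: "\<And>z. z \<in> U \<Longrightarrow> f z = b / 2 * (u z)\<^sup>2" and "open U" and u: "u holomorphic_on U" and z: "z \<in> U"
  shows "deriv f z = b * u z * deriv u z"
    and "(deriv ^^ 2) f z = b * (root_defect u z + 1)"
    and "(deriv ^^ 3) f z = b * deriv (root_defect u) z"
proof -
  have du: "(u has_field_derivative deriv u z) (at z)"
      "(deriv u has_field_derivative deriv (deriv u) z) (at z)" if "z \<in> U" for z
    using u \<open>open U\<close> that holomorphic_deriv[OF u \<open>open U\<close>] by (auto intro: holomorphic_derivI)
  have 1: "deriv f z = b * u z * deriv u z" if z: "z \<in> U" for z
  proof -
    have "((\<lambda>z. b / 2 * (u z)\<^sup>2) has_field_derivative b * u z * deriv u z) (at z)"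
      by (auto intro!: derivative_eq_intros du z)
    then show ?thesis using deriv_eq_on_open[OF \<open>open U\<close> z f] by (simp add: DERIV_imp_deriv)
  qed
  have 2: "deriv (deriv f) z = b * (root_defect u z + 1)" if z: "z \<in> U" for z
  proof -
    have "((\<lambda>z. b * u z * deriv u z) has_field_derivative b * (root_defect u z + 1)) (at z)"
      by (auto intro!: derivative_eq_intros du z simp: root_defect_def power2_eq_square algebra_simps)
    then show ?thesis using deriv_eq_on_open[OF \<open>open U\<close> z 1] by (simp add: DERIV_imp_deriv)
  qed
  have "(root_defect u has_field_derivative deriv (root_defect u) z) (at z)"
    using root_defect_holomorphic[OF u \<open>open U\<close>] \<open>open U\<close> z by (auto intro: holomorphic_derivI)
  then have "((\<lambda>z. b * (root_defect u z + 1)) has_field_derivative b * deriv (root_defect u) z) (at z)"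
    by (auto intro!: derivative_eq_intros)
  then have 3: "deriv (deriv (deriv f)) z = b * deriv (root_defect u) z"
    using deriv_eq_on_open[OF \<open>open U\<close> z 2] by (simp add: DERIV_imp_deriv)
  show "deriv f z = b * u z * deriv u z" "(deriv ^^ 2) f z = b * (root_defect u z + 1)"
    "(deriv ^^ 3) f z = b * deriv (root_defect u) z"
    using 1 2 3 z by (simp_all add: eval_nat_numeral)
qed

lemma spherical_bound_of_scaled_square:
  assumes f: "\<And>z. z \<in> U \<Longrightarrow> f z = b / 2 * (u z)\<^sup>2" and "open U" and u: "u holomorphic_on U" and "b \<noteq> 0"
    and "C \<ge> 0" and rate: "\<And>z. z \<in> U \<Longrightarrow> norm (deriv u z) \<le> C * (1 + (norm (u z))\<^sup>2)"
  shows "spherical_bounded_on U (2 * C * (norm b + 4 / norm b)) f"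
proof -
  have "f holomorphic_on U"
  proof (rule holomorphic_transform)
    show "(\<lambda>z. b / 2 * (u z)\<^sup>2) holomorphic_on U" by (intro holomorphic_intros u)
  qed (simp add: f)
  moreover have "norm (deriv f z) \<le> 2 * C * (norm b + 4 / norm b) * (1 + (norm (f z))\<^sup>2)" if z: "z \<in> U" for z
  proof -
    define t \<gamma> where "t = norm (u z)" and "\<gamma> = norm b"
    have t: "t \<ge> 0" and \<gamma>: "\<gamma> > 0" using \<open>b \<noteq> 0\<close> by (auto simp: t_def \<gamma>_def)
    have poly: "t * (1 + t\<^sup>2) \<le> 2 * (1 + t ^ 4)"
    proof (cases "t \<le> 1")
      case True
      then have "t * (1 + t\<^sup>2) \<le> 1 * (1 + 1)"
        using t by (intro mult_mono) (auto simp: power_le_one)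
      also have "\<dots> \<le> 2 * (1 + t ^ 4)" using t by simp
      finally show ?thesis .
    next
      case False
      then have "t \<le> t ^ 4" "t ^ 3 \<le> t ^ 4"
        using power_increasing[of 1 4 t] power_increasing[of 3 4 t] by auto
      then show ?thesis by (simp add: algebra_simps power2_eq_square power3_eq_cube)
    qed
    have "norm (deriv f z) = \<gamma> * t * norm (deriv u z)"
      using derivs_of_scaled_square(1)[OF f \<open>open U\<close> u z] by (simp add: norm_mult t_def \<gamma>_def)
    also have "\<dots> \<le> \<gamma> * t * (C * (1 + t\<^sup>2))"
      using rate[OF z] t \<gamma> by (intro mult_left_mono) (auto simp: t_def)
    also have "\<dots> = \<gamma> * C * (t * (1 + t\<^sup>2))" by simp
    also have "\<dots> \<le> \<gamma> * C * (2 * (1 + t ^ 4))"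
      using \<gamma> \<open>C \<ge> 0\<close> by (intro mult_left_mono poly) auto
    also have "\<dots> = 2 * C * (\<gamma> * (1 + t ^ 4))" by simp
    \<comment> \<open>Since |f|^2 = \<gamma>^2 t^4 / 4, the term \<gamma> t^4 equals (4/\<gamma>)
      |f|^2: the weight \<gamma> pays for the constant term and 4/\<gamma> for t^4.\<close>
    also have "\<dots> \<le> 2 * C * ((\<gamma> + 4 / \<gamma>) * (1 + (\<gamma> / 2 * t\<^sup>2)\<^sup>2))"
    proof (intro mult_left_mono)
      have "(\<gamma> + 4 / \<gamma>) * (1 + (\<gamma> / 2 * t\<^sup>2)\<^sup>2) = \<gamma> * (1 + t ^ 4) + 4 / \<gamma> + \<gamma> ^ 3 * t ^ 4 / 4"
        using \<gamma> by (simp add: field_simps power2_eq_square eval_nat_numeral)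
      then show "\<gamma> * (1 + t ^ 4) \<le> (\<gamma> + 4 / \<gamma>) * (1 + (\<gamma> / 2 * t\<^sup>2)\<^sup>2)"
        using \<gamma> t by simp
    qed (use \<open>C \<ge> 0\<close> in auto)
    also have "\<gamma> / 2 * t\<^sup>2 = norm (f z)"
      by (simp add: f[OF z] t_def \<gamma>_def norm_mult norm_power norm_divide)
    finally show ?thesis by (simp only: \<gamma>_def mult.assoc)
  qed
  ultimately show ?thesis by (simp add: spherical_bounded_on_def)
qed

text \<open>At a zero of \<open>u\<close> the rate is 0 by convention and says nothing about
  \<open>u'\<close>, so the first hypothesis supplies the bound there.\<close>

lemma zoom_rate_bound_imp:
  assumes "u z = 0 \<Longrightarrow> (deriv u z)\<^sup>2 = 1" and "zoom_rate u z \<le> C"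
  shows "norm (deriv u z) \<le> (3 + 3 * C\<^sup>2) * (1 + (norm (u z))\<^sup>2)"
proof (cases "u z = 0")
  case True
  then have "norm (deriv u z) = 1" using assms(1) norm_eq_1_if_square_eq_1 by blast
  then show ?thesis using True by simp
next
  case False
  then have "sqrt (max 0 (norm (deriv u z) - 3) / 3) \<le> C * norm (u z)"
    using assms(2) by (simp add: zoom_rate_def divide_le_eq)
  then have "max 0 (norm (deriv u z) - 3) / 3 \<le> (C * norm (u z))\<^sup>2"
    by (rule sqrt_le_D)
  then have "norm (deriv u z) \<le> 3 + 3 * (C\<^sup>2 * (norm (u z))\<^sup>2)"
    by (simp add: power_mult_distrib)
  also have "\<dots> \<le> (3 + 3 * C\<^sup>2) * (1 + (norm (u z))\<^sup>2)"
    by (simp add: distrib_left distrib_right)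
  finally show ?thesis .
qed

section \<open>From Euclidean to chordal convergence\<close>

lemma dist_sphere_point_le: "dist (sphere_point z) (sphere_point w) \<le> 2 * dist z w"
proof -
  have "1 \<le> sqrt (1 + (norm z)\<^sup>2) * sqrt (1 + (norm w)\<^sup>2)"
    using mult_mono[of 1 "sqrt (1 + (norm z)\<^sup>2)" 1 "sqrt (1 + (norm w)\<^sup>2)"] by simp
  then have "2 * norm (z - w) / (sqrt (1 + (norm z)\<^sup>2) * sqrt (1 + (norm w)\<^sup>2)) \<le> 2 * norm (z - w) / 1"
    by (intro divide_left_mono) auto
  then show ?thesis unfolding dist_sphere_point by (simp add: dist_norm)
qed

text \<open>Members of the family have no poles in \<open>D\<close>, so their sphere values are
  sphere points and the 2-Lipschitz bound applies. Here the finite limits are holomorphic, and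
  therefore nicely meromorphic.\<close>

lemma normal_family_onI:
  assumes "open D" and hol: "\<And>f. f \<in> \<F> \<Longrightarrow> f holomorphic_on D"
    and seq: "\<And>f :: nat \<Rightarrow> complex \<Rightarrow> complex. range f \<subseteq> \<F> \<Longrightarrow> \<exists>k :: nat \<Rightarrow> nat. strict_mono k \<and>
      ((\<exists>g. g holomorphic_on D \<and> (\<forall>K. compact K \<and> K \<subseteq> D \<longrightarrow> uniform_limit K (f \<circ> k) g sequentially)) \<or>
       (\<forall>K B. compact K \<and> K \<subseteq> D \<longrightarrow> (\<forall>\<^sub>F n in sequentially. \<forall>z\<in>K. B \<le> norm ((f \<circ> k) n z))))"
  shows "normal_family_on \<F> D"
  unfolding normal_family_on_def
proof (intro allI impI)
  fix f :: "nat \<Rightarrow> complex \<Rightarrow> complex" assume f: "range f \<subseteq> \<F>"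
  obtain k :: "nat \<Rightarrow> nat" where k: "strict_mono k"
    and alt: "(\<exists>g. g holomorphic_on D \<and> (\<forall>K. compact K \<and> K \<subseteq> D \<longrightarrow> uniform_limit K (f \<circ> k) g sequentially)) \<or>
       (\<forall>K B. compact K \<and> K \<subseteq> D \<longrightarrow> (\<forall>\<^sub>F n in sequentially. \<forall>z\<in>K. B \<le> norm ((f \<circ> k) n z)))"
    using seq[OF f] by blast
  have sv: "sphere_value (f n) z = sphere_point (f n z)" if "z \<in> D" for n z
    using f that by (intro sphere_value_holomorphic[OF _ \<open>open D\<close>] hol) auto
  have "(\<exists>g. g nicely_meromorphic_on D \<and>
            (\<forall>K. compact K \<and> K \<subseteq> D \<longrightarrow>
               uniform_limit K (\<lambda>n. sphere_value (f (k n))) (sphere_value g) sequentially)) \<or>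
          (\<forall>K. compact K \<and> K \<subseteq> D \<longrightarrow>
             uniform_limit K (\<lambda>n. sphere_value (f (k n))) (\<lambda>_. sphere_infinity) sequentially)"
    using alt
  proof (elim disjE exE conjE)
    fix g assume g: "g holomorphic_on D" and lim: "\<forall>K. compact K \<and> K \<subseteq> D \<longrightarrow> uniform_limit K (f \<circ> k) g sequentially"
    have "g nicely_meromorphic_on D"
      using g \<open>open D\<close> by (intro analytic_on_imp_nicely_meromorphic_on) (simp add: analytic_on_open)
    moreover have "uniform_limit K (\<lambda>n. sphere_value (f (k n))) (sphere_value g) sequentially"
      if K: "compact K" "K \<subseteq> D" for K
    proof (rule uniform_limitI)
      fix e :: real assume "e > 0"
      then have "\<forall>\<^sub>F n in sequentially. \<forall>z\<in>K. dist ((f \<circ> k) n z) (g z) < e / 2"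
        by (intro uniform_limitD[OF lim[rule_format, OF conjI[OF K]]]) simp
      then show "\<forall>\<^sub>F n in sequentially. \<forall>z\<in>K. dist (sphere_value (f (k n)) z) (sphere_value g z) < e"
      proof (rule eventually_mono, intro ballI)
        fix n z assume d: "\<forall>z\<in>K. dist ((f \<circ> k) n z) (g z) < e / 2" and z: "z \<in> K"
        have "z \<in> D" using z K by blast
        have "dist (sphere_value (f (k n)) z) (sphere_value g z) \<le> 2 * dist (f (k n) z) (g z)"
          unfolding sv[OF \<open>z \<in> D\<close>] sphere_value_holomorphic[OF g \<open>open D\<close> \<open>z \<in> D\<close>]
          by (rule dist_sphere_point_le)
        also have "\<dots> < e" using d[rule_format, OF z] by simp
        finally show "dist (sphere_value (f (k n)) z) (sphere_value g z) < e" .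
      qed
    qed
    ultimately show ?thesis by blast
  next
    assume inf: "\<forall>K B. compact K \<and> K \<subseteq> D \<longrightarrow> (\<forall>\<^sub>F n in sequentially. \<forall>z\<in>K. B \<le> norm ((f \<circ> k) n z))"
    have "uniform_limit K (\<lambda>n. sphere_value (f (k n))) (\<lambda>_. sphere_infinity) sequentially"
      if K: "compact K" "K \<subseteq> D" for K
    proof (rule uniform_limitI)
      \<comment> \<open>The chordal distance from w to infinity is 2/sqrt(1 + |w|^2), so |w| \<ge>
        2/e suffices.\<close>
      fix e :: real assume "e > 0"
      have "\<forall>\<^sub>F n in sequentially. \<forall>z\<in>K. 2 / e \<le> norm ((f \<circ> k) n z)"
        using inf K by blast
      then show "\<forall>\<^sub>F n in sequentially. \<forall>z\<in>K. dist (sphere_value (f (k n)) z) sphere_infinity < e"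
      proof (rule eventually_mono, intro ballI)
        fix n z assume d: "\<forall>z\<in>K. 2 / e \<le> norm ((f \<circ> k) n z)" and z: "z \<in> K"
        have "z \<in> D" using z K by blast
        have "2 / e \<le> norm (f (k n) z)" using d z by simp
        also have "\<dots> < sqrt (1 + (norm (f (k n) z))\<^sup>2)" by (rule real_less_rsqrt) simp
        finally have "2 / e < sqrt (1 + (norm (f (k n) z))\<^sup>2)" .
        moreover have "sqrt (1 + (norm (f (k n) z))\<^sup>2) > 0" by (simp add: add_pos_nonneg)
        ultimately show "dist (sphere_value (f (k n)) z) sphere_infinity < e"
          unfolding sv[OF \<open>z \<in> D\<close>] dist_sphere_infinity using \<open>e > 0\<close>
          by (simp add: divide_less_eq mult.commute)
      qed
    qed
    then show ?thesis by blast
  qed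
  then show "\<exists>r. strict_mono r \<and>
         ((\<exists>g. g nicely_meromorphic_on D \<and>
            (\<forall>K. compact K \<and> K \<subseteq> D \<longrightarrow>
               uniform_limit K (\<lambda>n. sphere_value (f (r n))) (sphere_value g) sequentially)) \<or>
          (\<forall>K. compact K \<and> K \<subseteq> D \<longrightarrow>
             uniform_limit K (\<lambda>n. sphere_value (f (r n))) (\<lambda>_. sphere_infinity) sequentially))"
    using k by blast
qed

section \<open>Compactness of the zoomed roots\<close>

lemma entire_limit_tendsto:
  assumes "entire_limit V v"
  shows "(\<lambda>n. V n z) \<longlonglongrightarrow> v z"
  using tendsto_uniform_limitI[OF entire_limit_cball(1)[OF assms, of z 1], of z] by simp

text \<open>The bound is uniform in \<open>u\<close>, which is what turns it into a statement about
  families. If it failed, zooms with N = 1, 2, 3, ... would give functions with spherical derivative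
  at most 12 on growing discs, and Marty's criterion a limit on the plane.\<close>

lemma admissible_root_zoom_rate_bounded:
  assumes "r > 0" "M \<ge> 0"
  shows "\<exists>C. \<forall>u. admissible_root \<beta> M (ball x r) u \<longrightarrow> (\<forall>y\<in>ball x (r/2). zoom_rate u y \<le> C)"
proof (rule ccontr)
  assume unbounded: "\<not> ?thesis"
  have "\<exists>v. admissible_root \<beta> (M / real (Suc n)) (ball 0 (real (Suc n))) v
      \<and> (\<forall>z\<in>ball 0 (real (Suc n)). norm (deriv v z) \<le> 3 + 12 * (norm (v z))\<^sup>2)
      \<and> norm (deriv v 0) = 3 + 3 * (norm (v 0))\<^sup>2" for n
  proof -
    define C where "C = max (4 * real (Suc n)) (8 * real (Suc n) / r)"
    obtain u y where u: "admissible_root \<beta> M (ball x r) u" "y \<in> ball x (r/2)" "zoom_rate u y > C"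
      using unbounded by (meson not_le)
    have "zoom_rate u y \<ge> 4 * real (Suc n)" "zoom_rate u y \<ge> 8 * real (Suc n) / r"
      using u(3) by (simp_all add: C_def)
    from admissible_root_zoom[OF u(1) assms _ u(2) this] show ?thesis
      by (metis of_nat_0_less_iff zero_less_Suc)
  qed
  then obtain V where adm: "\<And>n. admissible_root \<beta> (M / real (Suc n)) (ball 0 (real (Suc n))) (V n)"
    and growth: "\<And>n z. z \<in> ball 0 (real (Suc n)) \<Longrightarrow> norm (deriv (V n) z) \<le> 3 + 12 * (norm (V n z))\<^sup>2"
    and centre: "\<And>n. norm (deriv (V n) 0) = 3 + 3 * (norm (V n 0))\<^sup>2"
    by metis
  have evR: "\<forall>\<^sub>F n in sequentially. R \<le> real (Suc n)" for R
  proof -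
    have "\<forall>\<^sub>F n in sequentially. R \<le> real n"
      using filterlim_real_sequentially by (simp add: filterlim_at_top)
    then show ?thesis by (rule eventually_mono) simp
  qed
  have adm_mono: "admissible_root \<beta> (M / real (Suc n)) (ball 0 R) (V n)" if "R \<le> real (Suc n)" for R n
  proof -
    have "ball 0 R \<subseteq> ball (0::complex) (real (Suc n))" using that by (rule subset_ball)
    then show ?thesis
      using adm[of n] unfolding admissible_root_def by (meson holomorphic_on_subset subsetD)
  qed
  have sph: "spherical_bounded_on (ball 0 R) 12 (V n)" if "R \<le> real (Suc n)" for R n
    unfolding spherical_bounded_on_def
  proof (intro conjI ballI)
    show "V n holomorphic_on ball 0 R" using adm_mono[OF that] by (simp add: admissible_root_def)
    fix z :: complex assume "z \<in> ball 0 R"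
    then have "z \<in> ball 0 (real (Suc n))" using that by auto
    then show "norm (deriv (V n) z) \<le> 12 * (1 + (norm (V n z))\<^sup>2)"
      using growth[of z n] by simp
  qed
  obtain k :: "nat \<Rightarrow> nat" where k: "strict_mono k" and alt:
    "(\<exists>g. g holomorphic_on UNIV \<and> (\<forall>K. compact K \<and> K \<subseteq> UNIV \<longrightarrow> uniform_limit K (V \<circ> k) g sequentially)) \<or>
     (\<forall>K B. compact K \<and> K \<subseteq> UNIV \<longrightarrow> (\<forall>\<^sub>F n in sequentially. \<forall>z\<in>K. B \<le> norm ((V \<circ> k) n z)))"
  proof (rule Marty_sequence[OF open_UNIV connected_UNIV UNIV_not_empty, of V])
    fix x :: complex
    have sub: "ball x 1 \<subseteq> ball 0 (norm x + 1)"
    proof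
      fix z assume "z \<in> ball x 1"
      then show "z \<in> ball 0 (norm x + 1)"
        using norm_triangle_sub[of z x] by (simp add: dist_norm norm_minus_commute)
    qed
    have "\<forall>\<^sub>F n in sequentially. spherical_bounded_on (ball x 1) 12 (V n)"
      using evR[of "norm x + 1"]
    proof (rule eventually_mono)
      fix n assume "norm x + 1 \<le> real (Suc n)"
      from sph[OF this] show "spherical_bounded_on (ball x 1) 12 (V n)"
        using sub unfolding spherical_bounded_on_def by (meson holomorphic_on_subset subsetD)
    qed
    then show "\<exists>r>0. \<exists>C. ball x r \<subseteq> UNIV \<and> (\<forall>\<^sub>F n in sequentially. spherical_bounded_on (ball x r) C (V n))"
      by (intro exI[of _ 1]) auto
  qed blast+
  have evRk: "\<forall>\<^sub>F n in sequentially. R \<le> real (Suc (k n))" for R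
    using evR[of R] k by (rule eventually_subseq[rotated])
  show False
    using alt
  proof (elim disjE exE conjE)
    fix g assume g: "g holomorphic_on UNIV"
      and lim: "\<forall>K. compact K \<and> K \<subseteq> UNIV \<longrightarrow> uniform_limit K (V \<circ> k) g sequentially"
    have el: "entire_limit (\<lambda>n. V (k n)) g"
      unfolding entire_limit_def
    proof (intro conjI allI g)
      fix R :: real
      show "\<forall>\<^sub>F n in sequentially. V (k n) holomorphic_on ball 0 R"
        using evRk[of R] by (rule eventually_mono) (use adm_mono in \<open>auto simp: admissible_root_def\<close>)
      have "uniform_limit (cball 0 R) (V \<circ> k) g sequentially" using lim by simp
      then show "uniform_limit (ball 0 R) (\<lambda>n. V (k n)) g sequentially"
        unfolding o_def by (rule uniform_limit_on_subset) simp
    qed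
    have "root_limit (\<lambda>n. V (k n)) g \<beta> (\<lambda>n. M / real (Suc (k n))) 12"
    proof
      show "entire_limit (\<lambda>n. V (k n)) g" by (rule el)
      show "(\<lambda>n. M / real (Suc (k n))) \<longlonglongrightarrow> 0"
        using LIMSEQ_subseq_LIMSEQ[OF LIMSEQ_Suc[OF lim_const_over_n[of M]] k] by (simp add: o_def)
      show "\<forall>\<^sub>F n in sequentially. admissible_root \<beta> (M / real (Suc (k n))) (ball 0 R) (V (k n))" for R
        using evRk[of R] by (rule eventually_mono) (rule adm_mono)
      have "norm (deriv g z) \<le> 12 * (1 + (norm (g z))\<^sup>2)" for z
      proof (rule tendsto_le[OF sequentially_bot])
        show "(\<lambda>n. norm (deriv (V (k n)) z)) \<longlonglongrightarrow> norm (deriv g z)"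
          by (intro tendsto_norm entire_limit_tendsto[OF entire_limit_deriv[OF el]])
        show "(\<lambda>n. 12 * (1 + (norm (V (k n) z))\<^sup>2)) \<longlonglongrightarrow> 12 * (1 + (norm (g z))\<^sup>2)"
          by (intro tendsto_intros entire_limit_tendsto[OF el])
        show "\<forall>\<^sub>F n in sequentially. norm (deriv (V (k n)) z) \<le> 12 * (1 + (norm (V (k n) z))\<^sup>2)"
          using evRk[of "norm z + 1"]
        proof (rule eventually_mono)
          fix n assume "norm z + 1 \<le> real (Suc (k n))"
          from sph[OF this] show "norm (deriv (V (k n)) z) \<le> 12 * (1 + (norm (V (k n) z))\<^sup>2)"
            unfolding spherical_bounded_on_def by simp
        qed
      qed
      then show "spherical_bounded_on UNIV 12 g" using g by (simp add: spherical_bounded_on_def)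
      have "(\<lambda>n. norm (deriv (V (k n)) 0)) \<longlonglongrightarrow> norm (deriv g 0)"
        by (intro tendsto_norm entire_limit_tendsto[OF entire_limit_deriv[OF el]])
      then show "3 \<le> norm (deriv g 0)"
        by (rule tendsto_lowerbound) (simp_all add: centre)
    qed
    then show False by (rule root_limit.contradiction)
  next
    \<comment> \<open>The limit cannot be infinity: 1/f would be bounded by 1 on the unit disc, so
      |f'(0)| \<le> |f(0)|^2 by Cauchy, whereas the normalization of the zoom is |f'(0)| = 3 + 3
      |f(0)|^2.\<close>
    assume "\<forall>K B. compact K \<and> K \<subseteq> UNIV \<longrightarrow> (\<forall>\<^sub>F n in sequentially. \<forall>z\<in>K. B \<le> norm ((V \<circ> k) n z))"
    then have "\<forall>\<^sub>F n in sequentially. \<forall>z\<in>cball 0 1. 1 \<le> norm ((V \<circ> k) n z)" by simp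
    then have "\<forall>\<^sub>F n in sequentially. (\<forall>z\<in>cball 0 1. 1 \<le> norm ((V \<circ> k) n z)) \<and> 2 \<le> real (Suc (k n))"
      using evRk[of 2] by (rule eventually_conj)
    then obtain n where n: "\<And>z. z \<in> cball 0 1 \<Longrightarrow> 1 \<le> norm (V (k n) z)" "2 \<le> real (Suc (k n))"
      using eventually_happens'[OF sequentially_bot] by fastforce
    define f where "f = V (k n)"
    have fhol: "f holomorphic_on ball 0 2"
      using adm_mono[OF n(2)] by (simp add: f_def admissible_root_def)
    have f1: "1 \<le> norm (f z)" if "z \<in> cball 0 1" for z using n(1)[OF that] by (simp add: f_def)
    have ihol: "(\<lambda>z. inverse (f z)) holomorphic_on cball 0 1"
    proof (rule holomorphic_on_inverse)
      show "f holomorphic_on cball 0 1" by (rule holomorphic_on_subset[OF fhol]) auto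
      show "f z \<noteq> 0" if "z \<in> cball 0 1" for z using f1[OF that] by auto
    qed
    have "norm ((deriv ^^ 1) (\<lambda>z. inverse (f z)) 0) \<le> fact 1 * 1 / 1 ^ 1"
    proof (rule Cauchy_inequality)
      show "(\<lambda>z. inverse (f z)) holomorphic_on ball 0 1"
        using ihol by (rule holomorphic_on_subset) auto
      show "continuous_on (cball 0 1) (\<lambda>z. inverse (f z))"
        using ihol by (rule holomorphic_on_imp_continuous_on)
      show "norm (inverse (f z)) \<le> 1" if "norm (0 - z) = 1" for z
      proof -
        have "1 \<le> norm (f z)" using that by (intro f1) simp
        then show ?thesis by (simp add: norm_inverse inverse_le_1_iff)
      qed
    qed simp
    moreover have f0: "f 0 \<noteq> 0" using f1[of 0] by auto
    have "(f has_field_derivative deriv f 0) (at 0)"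
      by (rule holomorphic_derivI[OF fhol]) auto
    from DERIV_imp_deriv[OF DERIV_inverse'[OF this f0]]
    have "deriv (\<lambda>z. inverse (f z)) 0 = - (inverse (f 0) * deriv f 0 * inverse (f 0))" .
    ultimately have "inverse (norm (f 0)) * norm (deriv f 0) * inverse (norm (f 0)) \<le> 1"
      by (simp add: norm_mult norm_inverse)
    then have "norm (deriv f 0) \<le> (norm (f 0))\<^sup>2"
      using f0 by (simp add: field_simps power2_eq_square)
    moreover have "norm (deriv f 0) = 3 + 3 * (norm (f 0))\<^sup>2" using centre[of "k n"] by (simp add: f_def)
    ultimately show False using zero_le_power2[of "norm (f 0)"] by linarith
  qed
qed

theorem theorem1:
  fixes D :: "complex set"
    and \<F> :: "(complex \<Rightarrow> complex) set"
    and b B :: complex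
    and M :: real
  assumes "open D" and "connected D" and "D \<noteq> {}"
    and "\<And>f. f \<in> \<F> \<Longrightarrow> f holomorphic_on D"
    and "\<And>f z. f \<in> \<F> \<Longrightarrow> z \<in> D \<Longrightarrow> f z = 0 \<Longrightarrow> zorder f z \<ge> 2"
    and "b \<noteq> 0" and "B \<noteq> 0" and "M > 0"
    and "\<And>f z. f \<in> \<F> \<Longrightarrow> z \<in> D \<Longrightarrow> f z = 0 \<Longrightarrow> (deriv ^^ 2) f z = b"
    and "\<And>f z. f \<in> \<F> \<Longrightarrow> z \<in> D \<Longrightarrow> (deriv ^^ 2) f z = b \<Longrightarrow>
           0 < cmod ((deriv ^^ 3) f z) \<and> cmod ((deriv ^^ 3) f z) \<le> M"
    and "\<And>f z. f \<in> \<F> \<Longrightarrow> z \<in> D \<Longrightarrow> (deriv ^^ 2) f z = b \<Longrightarrow>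
           (deriv f z)\<^sup>2 = B * f z"
  shows "normal_family_on \<F> D"
proof (rule normal_family_onI[OF \<open>open D\<close> assms(4)])
  note hol = assms(4) and mult = assms(5) and zero = assms(9) and third = assms(10) and sq = assms(11)
  define \<beta> where "\<beta> = B / (2 * b)"
  \<comment> \<open>Condition (1) with \<open>b \<noteq> 0\<close> excludes the zero function, which
    has to be ruled out before zeros can be divided out.\<close>
  have nz: "\<exists>w\<in>D. f w \<noteq> 0" if f: "f \<in> \<F>" for f
  proof (rule ccontr)
    assume "\<not> ?thesis"
    then have f0: "\<And>z. z \<in> D \<Longrightarrow> f z = 0" by blast
    obtain z where z: "z \<in> D" using \<open>D \<noteq> {}\<close> by blast
    have d1: "deriv f y = 0" if "y \<in> D" for y
      using deriv_eq_on_open[OF \<open>open D\<close> that, of f "\<lambda>_. 0"] f0 by simp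
    have "(deriv ^^ 2) f z = 0"
      using deriv_eq_on_open[OF \<open>open D\<close> z, of "deriv f" "\<lambda>_. 0"] d1 by (simp add: eval_nat_numeral)
    then show False using zero[OF f z f0[OF z]] \<open>b \<noteq> 0\<close> by simp
  qed
  have local_bound: "\<exists>r>0. \<exists>C. ball x r \<subseteq> D \<and> (\<forall>f\<in>\<F>. spherical_bounded_on (ball x r) C f)" if x: "x \<in> D" for x
  proof -
    obtain r where r: "r > 0" "cball x r \<subseteq> D"
      using \<open>open D\<close> x open_contains_cball by blast
    have "M / norm b \<ge> 0" using \<open>M > 0\<close> by simp
    then obtain C where C: "\<And>u y. admissible_root \<beta> (M / norm b) (ball x r) u \<Longrightarrow> y \<in> ball x (r/2) \<Longrightarrow> zoom_rate u y \<le> C"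
      using admissible_root_zoom_rate_bounded[OF \<open>r > 0\<close>] by blast
    have subD: "ball x r \<subseteq> D" using r(2) by auto
    have sub2: "ball x (r/2) \<subseteq> ball x r" using r(1) by (intro subset_ball) simp
    have "spherical_bounded_on (ball x (r/2)) (2 * (3 + 3 * C\<^sup>2) * (norm b + 4 / norm b)) f" if f: "f \<in> \<F>" for f
    proof -
      obtain w where w: "w \<in> D" "f w \<noteq> 0" using nz[OF f] by blast
      have fb: "(\<lambda>z. f z / (b / 2)) holomorphic_on D"
        using \<open>b \<noteq> 0\<close> by (intro holomorphic_intros hol f) auto
      have ord: "zorder f z = 2" if "z \<in> D" "f z = 0" for z
        using mult[OF f that] zero[OF f that] \<open>b \<noteq> 0\<close>
        by (intro zorder_eq_2[OF hol[OF f] \<open>open D\<close> that]) auto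
      obtain h where h: "h holomorphic_on ball x r" "\<And>z. z \<in> ball x r \<Longrightarrow> f z = (h z)\<^sup>2"
        using holomorphic_sqrt_of_double_zeros[OF hol[OF f] assms(1,2) r(2,1) w ord] by blast
      \<comment> \<open>Dividing by a root of b/2 normalizes the root: at a zero of \<open>f\<close>
        the second derivative is b u'^2, so condition (1) becomes u'^2 = 1.\<close>
      define u where "u = (\<lambda>z. h z / csqrt (b / 2))"
      have fu: "f z = b / 2 * (u z)\<^sup>2" if "z \<in> ball x r" for z
        using h(2)[OF that] \<open>b \<noteq> 0\<close> by (simp add: u_def power_divide)
      have uhol: "u holomorphic_on ball x r"
        unfolding u_def using \<open>b \<noteq> 0\<close> by (intro holomorphic_intros h(1)) auto
      note d = derivs_of_scaled_square[OF fu open_ball uhol]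
      have adm: "admissible_root \<beta> (M / norm b) (ball x r) u"
        unfolding admissible_root_def
      proof (intro conjI ballI impI uhol)
        fix z assume z: "z \<in> ball x r"
        have zD: "z \<in> D" using z subD by blast
        have second: "root_defect u z = 0 \<longleftrightarrow> (deriv ^^ 2) f z = b"
          using d(2)[OF _ z] \<open>b \<noteq> 0\<close> by simp
        {
          assume u0: "u z = 0"
          then have "f z = 0" using fu[OF z] by simp
          then have "root_defect u z = 0" using zero[OF f zD] second by simp
          then show "(deriv u z)\<^sup>2 = 1" using u0 by (simp add: root_defect_def)
        next
          assume "root_defect u z = 0"
          then have fb: "(deriv ^^ 2) f z = b" using second by simp
          \<comment> \<open>Condition (3) in terms of \<open>u\<close>. The factor u^2 b splits off,
            and what is left is u'^2 = B/(2b), the origin of \<open>\<beta>\<close>.\<close>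
          have "(b * u z * deriv u z)\<^sup>2 = B * (b / 2 * (u z)\<^sup>2)"
            using sq[OF f zD fb] d(1)[OF _ z] fu[OF z] by simp
          then have "(u z)\<^sup>2 * (2 * b * (deriv u z)\<^sup>2 - B) * b = 0"
            by (simp add: power_mult_distrib algebra_simps power2_eq_square)
          then show "u z = 0 \<or> (deriv u z)\<^sup>2 = \<beta>"
            using \<open>b \<noteq> 0\<close> by (auto simp: \<beta>_def field_simps)
          have "norm ((deriv ^^ 3) f z) = norm b * norm (deriv (root_defect u) z)"
            using d(3)[OF _ z] by (simp add: norm_mult)
          then show "0 < norm (deriv (root_defect u) z)" "norm (deriv (root_defect u) z) \<le> M / norm b"
            using third[OF f zD fb] \<open>b \<noteq> 0\<close> by (auto simp: field_simps zero_less_mult_iff)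
        }
      qed
      show ?thesis
      proof (rule spherical_bound_of_scaled_square[OF _ open_ball _ \<open>b \<noteq> 0\<close>])
        show "f z = b / 2 * (u z)\<^sup>2" if "z \<in> ball x (r/2)" for z
          using fu that sub2 by blast
        show "u holomorphic_on ball x (r/2)" using uhol sub2 by (rule holomorphic_on_subset)
        show "norm (deriv u z) \<le> (3 + 3 * C\<^sup>2) * (1 + (norm (u z))\<^sup>2)" if z: "z \<in> ball x (r/2)" for z
        proof (rule zoom_rate_bound_imp)
          show "zoom_rate u z \<le> C" by (rule C[OF adm z])
          show "(deriv u z)\<^sup>2 = 1" if "u z = 0"
            using adm that z sub2 unfolding admissible_root_def by blast
        qed
      qed simp
    qed
    then show ?thesis using r(1) subD sub2 by (intro exI[of _ "r/2"]) auto
  qed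
  show "\<exists>k :: nat \<Rightarrow> nat. strict_mono k \<and>
      ((\<exists>g. g holomorphic_on D \<and> (\<forall>K. compact K \<and> K \<subseteq> D \<longrightarrow> uniform_limit K (f \<circ> k) g sequentially)) \<or>
       (\<forall>K B. compact K \<and> K \<subseteq> D \<longrightarrow> (\<forall>\<^sub>F n in sequentially. \<forall>z\<in>K. B \<le> norm ((f \<circ> k) n z))))"
    if f: "range f \<subseteq> \<F>" for f :: "nat \<Rightarrow> complex \<Rightarrow> complex"
  proof -
    have "\<exists>r>0. \<exists>C. ball x r \<subseteq> D \<and> (\<forall>\<^sub>F n in sequentially. spherical_bounded_on (ball x r) C (f n))"
      if x: "x \<in> D" for x
    proof -
      obtain r C where "r > 0" "ball x r \<subseteq> D" and C: "\<And>f. f \<in> \<F> \<Longrightarrow> spherical_bounded_on (ball x r) C f"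
        using local_bound[OF x] by blast
      moreover have "\<forall>\<^sub>F n in sequentially. spherical_bounded_on (ball x r) C (f n)"
        using f by (intro always_eventually allI C) auto
      ultimately show ?thesis by blast
    qed
    then obtain k :: "nat \<Rightarrow> nat" where "strict_mono k"
      "(\<exists>g. g holomorphic_on D \<and> (\<forall>K. compact K \<and> K \<subseteq> D \<longrightarrow> uniform_limit K (f \<circ> k) g sequentially)) \<or>
       (\<forall>K B. compact K \<and> K \<subseteq> D \<longrightarrow> (\<forall>\<^sub>F n in sequentially. \<forall>z\<in>K. B \<le> norm ((f \<circ> k) n z)))"
      by (rule Marty_sequence[OF assms(1-3)]) blast+
    then show ?thesis by blast
  qed
qed

end
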